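(* Let $f_1,\dots,f_n$, $W$, the iterates $x_{(i)}(k)$ and the notation be as in the context. Suppose $f=\sum_{i=1}^n f_i$ is either strongly convex with modulus $\mu_f>0$ or restricted strongly convex with modulus $\nu_f>0$, with $c_1,c_2$ the corresponding constants defined in the context. Suppose $\beta<1$ and the stepsize $\alpha>0$ satisfies $$\alpha\le\min\Big\{\frac{1+\lambda_n(W)}{L_h},\,c_1\Big\}.$$ Let $\bar e(k)=\bar x(k)-\mathrm{Proj}_{\mathcal{X}^*}(\bar x(k))$, where $\bar x(k)=\frac1n\sum_{i=1}^nx_{(i)}(k)$. Then for every constant $\delta>0$ and all $k\ge0$, $$\|\bar e(k+1)\|^2\le c_3^2\|\bar e(k)\|^2+c_4^2,$$ where $$c_3^2=1-\alpha c_2+\alpha\delta-\alpha^2\delta c_2,\qquad c_4^2=\alpha^3(\alpha+\delta^{-1})\frac{L_h^2D^2}{(1-\beta)^2},\qquad D=\sqrt{2L_h\sum_{i=1}^n\big(f_i(0)-f_i^o\big)}.$$ In particular, if one sets $\delta=\frac{c_2}{2(1-\alpha c_2)}$ such that $c_3=\sqrt{1-\frac{\alpha c_2}{2}}\in(0,1)$, then for all $k\ge0$ $$\|\bar e(k)\|\le c_3^k\|\bar e(0)\|+O\Big(\frac{\alpha}{1-\beta}\Big),$$ where the constant implied in $O(\cdot)$ depends only on $L_h$, $D$ and $c_2$.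
   Context: Standing assumptions. (a) Each $f_i:\mathbb{R}^p\to\mathbb{R}$ is proper closed convex, lower bounded, attains its minimum $f_i^o=\min f_i$, and is differentiable with $\nabla f_i$ Lipschitz continuous with constant $L_{f_i}>0$. (b) $W=[w_{ij}]\in\mathbb{R}^{n\times n}$ is symmetric and doubly stochastic, with eigenvalues $1=\lambda_1(W)\ge\dots\ge\lambda_n(W)\ge-1$ and $\beta:=\max\{|\lambda_2(W)|,|\lambda_n(W)|\}<1$. (c) The set $\mathcal{X}^*$ of minimizers of $f=\sum_{i=1}^n f_i$ is non-empty. Iteration: $x_{(i)}(0)=0$ and $x_{(i)}(k+1)=\sum_{j=1}^n w_{ij}x_{(j)}(k)-\alpha\nabla f_i(x_{(i)}(k))$, $i=1,\dots,n$. $f$ is strongly convex with modulus $\mu_f$ if $\langle\nabla f(x_a)-\nabla f(x_b),x_a-x_b\rangle\ge\mu_f\|x_a-x_b\|^2$ for all $x_a,x_b$. $f$ is restricted strongly convex with modulus $\nu_f$ if $\langle\nabla f(x)-\nabla f(x^* ),x-x^*\rangle\ge\nu_f\|x-x^*\|^2$ for all $x$, where $x^*=\mathrm{Proj}_{\mathcal{X}^*}(x)$ is the Euclidean projection (so $\nabla f(x^* )=0$). Constants: $L_h=\max_iL_{f_i}$, $L_{\bar f}=\frac1n\sum_{i=1}^nL_{f_i}$, $\mu_{\bar f}=\mu_f/n$, $\nu_{\bar f}=\nu_f/n$. In the strongly convex case $c_1=\frac1{\mu_{\bar f}+L_{\bar f}}$ and $c_2=\frac{\mu_{\bar f}L_{\bar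 f}}{\mu_{\bar f}+L_{\bar f}}$. In the restricted strongly convex case $c_1=\frac{\theta}{L_{\bar f}}$ and $c_2=(1-\theta)\nu_{\bar f}$ for any fixed $\theta\in[0,1]$. Norms are Euclidean.
   Formalization: In the last part c_2>0 (so θ<1) is assumed, since θ=1 gives δ=0 and c_3=1; and δ>0, the formula for c_3 and c_3∈(0,1) are asserted only for non-constant f, since for constant f the modulus ν_f can be arbitrarily large. The final bound holds for constant f too. *)

theory Defs
  imports
    "HOL-Analysis.Analysis"
    "Jordan_Normal_Form.Char_Poly"
begin

text \<open>
  The constant hidden in the final \<open>O\<close>-term may depend on neither the dimension \<open>p\<close> nor the
  number \<open>n\<close> of agents, so both have to be quantified inside the scope of that constant and cannot
  be types.  All the spaces \<open>R\<^sup>p\<close> are therefore taken as the coordinate subspaces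
  \<open>{x. x\<^sub>j = 0 for j \<ge> p}\<close> of one inner product space: the finitely supported real sequences
  with \<open>\<langle>x, y\<rangle> = (\<Sum>j. x\<^sub>j y\<^sub>j)\<close>.  On \<open>R\<^sup>p\<close> this is the usual Euclidean inner
  product.  Agents and coordinates are numbered from 0.
\<close>

typedef fvec = "{x :: nat \<Rightarrow> real. finite {j. x j \<noteq> 0}}"
  morphisms coord Abs_fvec
  by (rule exI[of _ "\<lambda>_. 0"]) simp

setup_lifting type_definition_fvec

lemma fvec_eqI: "(\<And>j. coord x j = coord y j) \<Longrightarrow> x = y"
  by (simp add: coord_inject[symmetric] fun_eq_iff)

lemma finite_support [simp]: "finite {j. coord x j \<noteq> 0}"
  using coord[of x] by simp

instantiation fvec :: real_vector
begin

lift_definition zero_fvec :: fvec is "\<lambda>_. 0"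
  by simp

lift_definition plus_fvec :: "fvec \<Rightarrow> fvec \<Rightarrow> fvec" is "\<lambda>x y j. x j + y j"
  by (rule finite_subset[rotated], rule finite_UnI, assumption, assumption) auto

lift_definition uminus_fvec :: "fvec \<Rightarrow> fvec" is "\<lambda>x j. - x j"
  by simp

lift_definition minus_fvec :: "fvec \<Rightarrow> fvec \<Rightarrow> fvec" is "\<lambda>x y j. x j - y j"
  by (rule finite_subset[rotated], rule finite_UnI, assumption, assumption) auto

lift_definition scaleR_fvec :: "real \<Rightarrow> fvec \<Rightarrow> fvec" is "\<lambda>r x j. r * x j"
  by (rule finite_subset[rotated], assumption) auto

instance
  by standard (transfer; simp add: fun_eq_iff algebra_simps)+

end

lemma coord_simps [simp]:
  "coord 0 j = 0"
  "coord (x + y) j = coord x j + coord y j"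
  "coord (- x) j = - coord x j"
  "coord (x - y) j = coord x j - coord y j"
  "coord (r *\<^sub>R x) j = r * coord x j"
  by (transfer; simp)+

instantiation fvec :: real_inner
begin

definition inner_fvec :: "fvec \<Rightarrow> fvec \<Rightarrow> real" where
  "inner_fvec x y = (\<Sum>j | coord x j \<noteq> 0. coord x j * coord y j)"

definition norm_fvec :: "fvec \<Rightarrow> real" where
  "norm_fvec x = sqrt (inner x x)"

definition sgn_fvec :: "fvec \<Rightarrow> fvec" where
  "sgn_fvec x = x /\<^sub>R norm x"

definition dist_fvec :: "fvec \<Rightarrow> fvec \<Rightarrow> real" where
  "dist_fvec x y = norm (x - y)"

definition uniformity_fvec :: "(fvec \<times> fvec) filter" where
  "uniformity_fvec = (INF e\<in>{0 <..}. principal {(x, y). dist x y < e})"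

definition open_fvec :: "fvec set \<Rightarrow> bool" where
  "open_fvec U = (\<forall>x\<in>U. eventually (\<lambda>(x', y). x' = x \<longrightarrow> y \<in> U) uniformity)"

lemma inner_fvec_superset:
  assumes "finite A" "{j. coord x j \<noteq> 0} \<subseteq> A"
  shows "inner x y = (\<Sum>j\<in>A. coord x j * coord y j)"
  unfolding inner_fvec_def using assms by (intro sum.mono_neutral_left) auto

instance
proof
  fix x y z :: fvec and r :: real
  let ?A = "{j. coord x j \<noteq> 0} \<union> {j. coord y j \<noteq> 0}"
  have fin: "finite ?A" by simp
  have x: "inner x u = (\<Sum>j\<in>?A. coord x j * coord u j)" for u
    by (rule inner_fvec_superset[OF fin]) auto
  have y: "inner y u = (\<Sum>j\<in>?A. coord y j * coord u j)" for u
    by (rule inner_fvec_superset[OF fin]) auto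
  have xy: "inner (x + y) u = (\<Sum>j\<in>?A. coord (x + y) j * coord u j)" for u
    by (rule inner_fvec_superset[OF fin]) auto
  have rx: "inner (r *\<^sub>R x) u = (\<Sum>j\<in>?A. coord (r *\<^sub>R x) j * coord u j)" for u
    by (rule inner_fvec_superset[OF fin]) auto
  show "inner x y = inner y x"
    unfolding x y by (simp add: mult.commute)
  show "inner (x + y) z = inner x z + inner y z"
    unfolding x y xy by (simp add: algebra_simps sum.distrib)
  show "inner (r *\<^sub>R x) y = r * inner x y"
    unfolding x rx by (simp add: sum_distrib_left mult.assoc)
  show "0 \<le> inner x x"
    by (simp add: inner_fvec_def sum_nonneg)
  show "inner x x = 0 \<longleftrightarrow> x = 0"
  proof
    assume "inner x x = 0"
    then have "\<forall>j\<in>{j. coord x j \<noteq> 0}. coord x j * coord x j = 0"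
      unfolding inner_fvec_def by (subst (asm) sum_nonneg_eq_0_iff) auto
    then show "x = 0"
      by (intro fvec_eqI) auto
  qed (simp add: inner_fvec_def)
qed (fact norm_fvec_def sgn_fvec_def dist_fvec_def uniformity_fvec_def open_fvec_def)+

end

definition Rp :: "nat \<Rightarrow> fvec set" where
  "Rp p = {x. \<forall>j\<ge>p. coord x j = 0}"


text \<open>
  Functions on \<open>R\<^sup>p\<close> are total functions on \<^typ>\<open>fvec\<close> of which only the values on
  \<^term>\<open>Rp p\<close> matter; in particular derivatives are taken within \<^term>\<open>Rp p\<close>.
\<close>

definition grad :: "nat \<Rightarrow> (fvec \<Rightarrow> real) \<Rightarrow> fvec \<Rightarrow> fvec" where
  "grad p f x = (THE g. g \<in> Rp p \<and> (f has_derivative inner g) (at x within Rp p))"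

definition minimizers :: "nat \<Rightarrow> (fvec \<Rightarrow> real) \<Rightarrow> fvec set" where
  "minimizers p f = {x \<in> Rp p. \<forall>y\<in>Rp p. f x \<le> f y}"

definition Proj :: "fvec set \<Rightarrow> fvec \<Rightarrow> fvec" where
  "Proj S x = arg_min_on (dist x) S"

definition strongly_convex :: "nat \<Rightarrow> (fvec \<Rightarrow> real) \<Rightarrow> real \<Rightarrow> bool" where
  "strongly_convex p f \<mu> \<longleftrightarrow>
     (\<forall>x\<in>Rp p. \<forall>y\<in>Rp p. inner (grad p f x - grad p f y) (x - y) \<ge> \<mu> * (norm (x - y))\<^sup>2)"

definition restricted_strongly_convex :: "nat \<Rightarrow> (fvec \<Rightarrow> real) \<Rightarrow> real \<Rightarrow> bool" where
  "restricted_strongly_convex p f \<nu> \<longleftrightarrow>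
     (\<forall>x\<in>Rp p. let x' = Proj (minimizers p f) x in
        inner (grad p f x - grad p f x') (x - x') \<ge> \<nu> * (norm (x - x'))\<^sup>2)"


text \<open>
  \<open>\<lambda>\<^sub>1(W) \<ge> \<lambda>\<^sub>2(W) \<ge> \<dots>\<close>, counted with multiplicity and indexed from 1.  For \<open>n = 1\<close> the
  value of \<open>\<lambda>\<^sub>2\<close> is unspecified, but then \<open>\<lambda>\<^sub>n = \<lambda>\<^sub>1 = 1\<close>, so \<open>\<beta> < 1\<close> excludes this case.
\<close>

definition eigval :: "real mat \<Rightarrow> nat \<Rightarrow> real" where
  "eigval W i = rev (sorted_list_of_multiset (proots (char_poly W))) ! (i - 1)"

definition beta :: "nat \<Rightarrow> real mat \<Rightarrow> real" where
  "beta n W = max \<bar>eigval W 2\<bar> \<bar>eigval W n\<bar>"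

definition doubly_stochastic :: "nat \<Rightarrow> real mat \<Rightarrow> bool" where
  "doubly_stochastic n W \<longleftrightarrow>
     (\<forall>i<n. \<forall>j<n. 0 \<le> W $$ (i, j)) \<and>
     (\<forall>i<n. (\<Sum>j<n. W $$ (i, j)) = 1) \<and> (\<forall>j<n. (\<Sum>i<n. W $$ (i, j)) = 1)"


definition fsum :: "nat \<Rightarrow> (nat \<Rightarrow> fvec \<Rightarrow> real) \<Rightarrow> fvec \<Rightarrow> real" where
  "fsum n f x = (\<Sum>i<n. f i x)"

text \<open>
  A convex real-valued function is proper, and a differentiable one is closed, so neither property
  appears as a separate assumption.
\<close>

locale dgd =
  fixes n p :: nat
    and f :: "nat \<Rightarrow> fvec \<Rightarrow> real"
    and L :: "nat \<Rightarrow> real"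
    and W :: "real mat"
  assumes n_pos: "0 < n" and p_pos: "0 < p"
    and f_convex: "i < n \<Longrightarrow> convex_on (Rp p) (f i)"
    and f_bounded_below: "i < n \<Longrightarrow> bdd_below (f i ` Rp p)"
    and f_attains_min: "i < n \<Longrightarrow> minimizers p (f i) \<noteq> {}"
    and f_differentiable: "i < n \<Longrightarrow> f i differentiable_on Rp p"
    and L_pos: "i < n \<Longrightarrow> 0 < L i"
    and grad_lipschitz: "i < n \<Longrightarrow> lipschitz_on (L i) (Rp p) (grad p (f i))"
    and W_dim: "W \<in> carrier_mat n n"
    and W_symmetric: "transpose_mat W = W"
    and W_stochastic: "doubly_stochastic n W"
    and eigval_first: "eigval W 1 = 1"
    and eigval_last: "eigval W n \<ge> -1"
    and beta_less_1: "beta n W < 1"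
    and minimizers_nonempty: "minimizers p (fsum n f) \<noteq> {}"

fun dgd_iter :: "nat \<Rightarrow> nat \<Rightarrow> (nat \<Rightarrow> fvec \<Rightarrow> real) \<Rightarrow> real mat \<Rightarrow> real \<Rightarrow> nat \<Rightarrow> nat \<Rightarrow> fvec" where
  "dgd_iter n p f W \<alpha> 0 i = 0"
| "dgd_iter n p f W \<alpha> (Suc k) i =
     (\<Sum>j<n. W $$ (i, j) *\<^sub>R dgd_iter n p f W \<alpha> k j)
     - \<alpha> *\<^sub>R grad p (f i) (dgd_iter n p f W \<alpha> k i)"

definition xbar :: "nat \<Rightarrow> nat \<Rightarrow> (nat \<Rightarrow> fvec \<Rightarrow> real) \<Rightarrow> real mat \<Rightarrow> real \<Rightarrow> nat \<Rightarrow> fvec" where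
  "xbar n p f W \<alpha> k = (1 / real n) *\<^sub>R (\<Sum>i<n. dgd_iter n p f W \<alpha> k i)"

definition ebar :: "nat \<Rightarrow> nat \<Rightarrow> (nat \<Rightarrow> fvec \<Rightarrow> real) \<Rightarrow> real mat \<Rightarrow> real \<Rightarrow> nat \<Rightarrow> fvec" where
  "ebar n p f W \<alpha> k = xbar n p f W \<alpha> k - Proj (minimizers p (fsum n f)) (xbar n p f W \<alpha> k)"

definition Lh :: "nat \<Rightarrow> (nat \<Rightarrow> real) \<Rightarrow> real" where
  "Lh n L = Max (L ` {..<n})"

definition Lbar :: "nat \<Rightarrow> (nat \<Rightarrow> real) \<Rightarrow> real" where
  "Lbar n L = (\<Sum>i<n. L i) / real n"

definition D_const :: "nat \<Rightarrow> nat \<Rightarrow> (nat \<Rightarrow> fvec \<Rightarrow> real) \<Rightarrow> (nat \<Rightarrow> real) \<Rightarrow> real" where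
  "D_const n p f L = sqrt (2 * Lh n L * (\<Sum>i<n. f i 0 - (INF x\<in>Rp p. f i x)))"

definition strong_constants ::
    "nat \<Rightarrow> nat \<Rightarrow> (nat \<Rightarrow> fvec \<Rightarrow> real) \<Rightarrow> (nat \<Rightarrow> real) \<Rightarrow> real \<Rightarrow> real \<Rightarrow> bool" where
  "strong_constants n p f L c1 c2 \<longleftrightarrow>
     (\<exists>\<mu>>0. strongly_convex p (fsum n f) \<mu> \<and>
        c1 = 1 / (\<mu> / real n + Lbar n L) \<and>
        c2 = (\<mu> / real n) * Lbar n L / (\<mu> / real n + Lbar n L))"

definition restricted_constants ::
    "nat \<Rightarrow> nat \<Rightarrow> (nat \<Rightarrow> fvec \<Rightarrow> real) \<Rightarrow> (nat \<Rightarrow> real) \<Rightarrow> real \<Rightarrow> real \<Rightarrow> bool" where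
  "restricted_constants n p f L c1 c2 \<longleftrightarrow>
     (\<exists>\<nu>>0. \<exists>\<theta>\<in>{0..1}. restricted_strongly_convex p (fsum n f) \<nu> \<and>
        c1 = \<theta> / Lbar n L \<and> c2 = (1 - \<theta>) * (\<nu> / real n))"

text \<open>
  The choice \<open>\<delta> = c\<^sub>2 / (2 (1 - \<alpha> c\<^sub>2))\<close> requires \<open>\<delta> > 0\<close>, that is, \<open>c\<^sub>2 > 0\<close>
  (i.e. \<open>\<theta> < 1\<close> in the restricted case) and \<open>\<alpha> c\<^sub>2 < 1\<close>.  The latter can only fail if
  every point minimizes \<open>f\<close>: a constant \<open>f\<close> is restricted strongly convex with every modulus.
\<close>

definition c3_sq :: "real \<Rightarrow> real \<Rightarrow> real \<Rightarrow> real" where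
  "c3_sq \<alpha> c2 \<delta> = 1 - \<alpha> * c2 + \<alpha> * \<delta> - \<alpha>\<^sup>2 * \<delta> * c2"

definition c4_sq :: "real \<Rightarrow> real \<Rightarrow> real \<Rightarrow> real \<Rightarrow> real \<Rightarrow> real" where
  "c4_sq \<alpha> \<delta> lh d b = \<alpha>^3 * (\<alpha> + inverse \<delta>) * (lh\<^sup>2 * d\<^sup>2 / (1 - b)\<^sup>2)"

end

theory Submission
  imports Defs
begin

text \<open>
  Under the step size bound the iteration is gradient descent, with an admissible step, for
  \<open>\<Sum>\<^sub>i f\<^sub>i(x\<^sub>i) + \<langle>x, (I - W) x\<rangle> / (2 \<alpha>)\<close>.  Hence \<open>\<Sum>\<^sub>i f\<^sub>i(x\<^sub>i(k)) \<le> \<Sum>\<^sub>i f\<^sub>i(0)\<close>,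
  which bounds the stacked gradients by \<open>D\<close>.  Since \<open>W\<close> contracts centered vectors by \<open>\<beta>\<close>, every
  agent stays within \<open>\<alpha> D / (1 - \<beta>)\<close> of the average.  The average therefore follows gradient
  descent for \<open>f / n\<close> up to an error of norm at most \<open>L\<^sub>h \<alpha> D / (1 - \<beta>)\<close> in the gradient.  In both
  cases of the theorem \<open>\<langle>\<nabla>f(x), e\<rangle> \<ge> \<nu> |e|\<^sup>2\<close> with \<open>e = x - Proj x\<close>, \<open>c\<^sub>2 \<le> \<nu> / n\<close> and
  \<open>\<alpha> Lbar \<le> 1\<close>, and this is all that the contraction of the exact step needs.
\<close>

text \<open>\<open>fvec\<close> is infinite-dimensional, so closed bounded sets need not be compact;
  nearest minimizers and extremal eigenvectors come from compactness inside a single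
  \<open>Rp p\<close>. \<open>beta\<close> is read off a sorted list of roots of the characteristic
  polynomial, whereas the dynamics needs an operator bound orthogonally to the constant vectors. No
  eigenbasis is built: maximizing a quadratic form on a sphere yields the one extremal eigenvector
  that each estimate needs, and a determinant argument shows that a second eigenvector for 1 makes 1
  a double root, so that \<open>eigval W 2\<close> accounts for it. Estimates across agents are
  Euclidean in the stacked vector, so no extra factor depending on the number of agents appears. The
  parameter \<open>\<delta>\<close> is the weight in Young's inequality between contracted error and
  gradient error. Its special value gives back half of the contraction; a squared error of order
  \<open>\<alpha>^3\<close> per step against a contraction of order \<open>\<alpha>\<close> leaves a
  residual of order \<open>\<alpha>\<close> after the square root.\<close>

unbundle no vec_syntax

section \<open>Coordinate spaces\<close>

lift_definition unit_fvec :: "nat \<Rightarrow> fvec" is "\<lambda>i j. if j = i then 1 else 0"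
  by (rule finite_subset[of _ "{_}"]) auto

lemma coord_unit_fvec [simp]: "coord (unit_fvec i) j = (if j = i then 1 else 0)"
  by transfer simp

lemma coord_sum [simp]: "coord (\<Sum>i\<in>A. x i) j = (\<Sum>i\<in>A. coord (x i) j)"
  by (induction A rule: infinite_finite_induct) simp_all

lemma inner_unit_fvec [simp]: "inner (unit_fvec j) x = coord x j" "inner x (unit_fvec j) = coord x j"
proof -
  show "inner (unit_fvec j) x = coord x j"
    by (subst inner_fvec_superset[of "{j}"]) (auto split: if_splits)
  then show "inner x (unit_fvec j) = coord x j"
    by (simp add: inner_commute)
qed

lemma abs_coord_le_norm: "\<bar>coord x j\<bar> \<le> norm x"
proof -
  have "norm (unit_fvec j) = 1"
    by (simp add: norm_eq_1)
  with Cauchy_Schwarz_ineq2[of x "unit_fvec j"] show ?thesis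
    by simp
qed

lemma subspace_Rp: "subspace (Rp p)"
  by (auto simp: subspace_def Rp_def)

lemmas Rp_closed_ops [simp] =
  subspace_0[OF subspace_Rp] subspace_add[OF subspace_Rp] subspace_diff[OF subspace_Rp]
  subspace_scale[OF subspace_Rp] subspace_neg[OF subspace_Rp]

lemma sum_in_Rp [simp]: "(\<And>i. i \<in> A \<Longrightarrow> x i \<in> Rp p) \<Longrightarrow> (\<Sum>i\<in>A. x i) \<in> Rp p"
  by (rule subspace_sum[OF subspace_Rp])

lemma convex_Rp: "convex (Rp p)"
  by (rule subspace_imp_convex[OF subspace_Rp])

lemma unit_fvec_in_Rp [simp]: "unit_fvec j \<in> Rp p \<longleftrightarrow> j < p"
  by (auto simp: Rp_def)

lemma inner_Rp: "x \<in> Rp p \<Longrightarrow> inner x y = (\<Sum>j<p. coord x j * coord y j)"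
  by (rule inner_fvec_superset) (auto simp: Rp_def not_le[symmetric])

lemma Rp_expansion: "x \<in> Rp p \<Longrightarrow> (\<Sum>j<p. coord x j *\<^sub>R unit_fvec j) = x"
  by (rule fvec_eqI) (auto simp: Rp_def if_distrib not_less cong: if_cong)

section \<open>Compactness and nearest points in coordinate spaces\<close>

lemma continuous_on_coord: "continuous_on S (\<lambda>x. coord x j)"
  unfolding inner_unit_fvec(2)[symmetric] by (intro continuous_intros)

lemma closed_Rp: "closed (Rp p)"
proof -
  have "Rp p = (\<Inter>j\<in>{p..}. {x. coord x j = 0})"
    by (auto simp: Rp_def)
  then show ?thesis
    by (auto intro!: closed_INT closed_Collect_eq continuous_on_coord)
qed

text \<open>By induction on \<open>p\<close>: the box with one more dimension is a continuous image
  of the product of two compact sets, the smaller box and the interval of the new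
  coordinate.\<close>

lemma compact_box_Rp: "compact {x \<in> Rp p. \<forall>j. \<bar>coord x j\<bar> \<le> B}"
proof (induction p)
  case 0
  have "{x \<in> Rp 0. \<forall>j. \<bar>coord x j\<bar> \<le> B} \<subseteq> {0}"
    by (auto simp: Rp_def intro: fvec_eqI)
  then show ?case
    using finite_imp_compact finite_subset by blast
next
  case (Suc p)
  let ?box = "\<lambda>p. {x \<in> Rp p. \<forall>j. \<bar>coord x j\<bar> \<le> B}"
  let ?g = "\<lambda>(x, t). x + t *\<^sub>R unit_fvec p"
  have "x \<in> ?g ` (?box p \<times> {-B..B})" if "x \<in> ?box (Suc p)" for x
  proof (rule image_eqI)
    show "x = ?g (x - coord x p *\<^sub>R unit_fvec p, coord x p)"
      by simp
    \<comment> \<open>Deleting coordinate \<open>p\<close> leaves a zero there, which must obey the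
      bound \<open>B\<close> as well.\<close>
    have "0 \<le> B"
      using that abs_ge_zero order_trans by blast
    moreover have "coord x j = 0" if "j > p" for j
      using \<open>x \<in> ?box (Suc p)\<close> that by (simp add: Rp_def)
    moreover have "\<bar>coord x j\<bar> \<le> B" for j
      using that by simp
    ultimately show "(x - coord x p *\<^sub>R unit_fvec p, coord x p) \<in> ?box p \<times> {-B..B}"
      by (simp add: Rp_def abs_le_iff) (metis minus_le_iff nat_less_le)
  qed
  moreover have "?g z \<in> ?box (Suc p)" if "z \<in> ?box p \<times> {-B..B}" for z
    using that by (auto simp: Rp_def)
  ultimately have "?box (Suc p) = ?g ` (?box p \<times> {-B..B})"
    by blast
  moreover have "compact (?g ` (?box p \<times> {-B..B}))"
    by (intro compact_continuous_image compact_Times Suc.IH)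
      (auto simp: case_prod_beta intro!: continuous_intros)
  ultimately show ?case by simp
qed

lemma compact_subset_Rp:
  assumes "closed S" "bounded S" "S \<subseteq> Rp p"
  shows "compact S"
proof -
  obtain B where "\<And>x. x \<in> S \<Longrightarrow> norm x \<le> B"
    using assms(2) by (auto simp: bounded_iff)
  then have "S \<subseteq> {x \<in> Rp p. \<forall>j. \<bar>coord x j\<bar> \<le> B}"
    using assms(3) abs_coord_le_norm order_trans by blast
  moreover have "compact ({x \<in> Rp p. \<forall>j. \<bar>coord x j\<bar> \<le> B} \<inter> S)"
    by (intro compact_Int_closed compact_box_Rp assms(1))
  ultimately show ?thesis
    by (simp only: inf_absorb2)
qed

text \<open>\<open>Proj\<close> is a choice and means something only once a minimum is attained.
  Cutting \<open>S\<close> with the ball around \<open>x\<close> through one of its points makes it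
  compact, and points outside this ball are farther away anyway.\<close>

lemma Proj_nearest:
  assumes "closed S" "S \<noteq> {}" "S \<subseteq> Rp p"
  shows "Proj S x \<in> S" "\<And>y. y \<in> S \<Longrightarrow> dist x (Proj S x) \<le> dist x y"
proof -
  obtain s where s: "s \<in> S"
    using assms(2) by blast
  have "compact (S \<inter> cball x (dist x s))"
    using assms by (intro compact_subset_Rp[of _ p]) auto
  moreover have "S \<inter> cball x (dist x s) \<noteq> {}"
    using s by auto
  moreover have "continuous_on (S \<inter> cball x (dist x s)) (dist x)"
    by (intro continuous_intros)
  ultimately have "\<exists>z \<in> S \<inter> cball x (dist x s). \<forall>y \<in> S \<inter> cball x (dist x s). dist x z \<le> dist x y"
    by (rule continuous_attains_inf)
  then obtain z where z: "z \<in> S \<inter> cball x (dist x s)"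
      "\<And>y. y \<in> S \<inter> cball x (dist x s) \<Longrightarrow> dist x z \<le> dist x y"
    by blast
  have "dist x z \<le> dist x y" if "y \<in> S" for y
    using z(1) z(2)[of y] that by (cases "dist x y \<le> dist x s") (simp_all add: not_le)
  then have "is_arg_min (dist x) (\<lambda>x. x \<in> S) z"
    using z(1) by (auto simp: is_arg_min_linorder)
  then have "is_arg_min (dist x) (\<lambda>x. x \<in> S) (Proj S x)"
    unfolding Proj_def arg_min_on_def arg_min_def by (rule someI)
  then show "Proj S x \<in> S" "\<And>y. y \<in> S \<Longrightarrow> dist x (Proj S x) \<le> dist x y"
    by (auto simp: is_arg_min_linorder)
qed

text \<open>The distance 0 is attained at \<open>x\<close>, so whatever point is chosen has distance
  0 from \<open>x\<close>.\<close>

lemma Proj_self: "x \<in> S \<Longrightarrow> Proj S x = x"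
  using arg_min_equality[of "\<lambda>y. y \<in> S" x "dist x"] by (simp add: Proj_def arg_min_on_def)

section \<open>Smooth convex functions\<close>

text \<open>\<open>g\<close> collects the partial derivatives. Difference quotients within
  \<open>Rp p\<close> only see directions in \<open>Rp p\<close>, where \<open>D\<close> and
  \<open>inner g\<close> agree, so one can be exchanged for the other.\<close>

lemma grad_exists:
  assumes "f differentiable (at x within Rp p)" "x \<in> Rp p"
  shows "\<exists>g\<in>Rp p. (f has_derivative inner g) (at x within Rp p)"
proof -
  obtain D where D: "(f has_derivative D) (at x within Rp p)"
    using assms(1) unfolding differentiable_def by blast
  then interpret bounded_linear D
    by (rule has_derivative_bounded_linear)
  define g where "g = (\<Sum>j<p. D (unit_fvec j) *\<^sub>R unit_fvec j)"
  have D_eq: "D d = inner g d" if "d \<in> Rp p" for d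
  proof -
    have "D d = D (\<Sum>j<p. coord d j *\<^sub>R unit_fvec j)"
      using Rp_expansion[OF that] by simp
    then show ?thesis
      by (simp add: sum scaleR g_def inner_sum_left mult.commute)
  qed
  have "((\<lambda>y. (1 / norm (y - x)) *\<^sub>R (f y - (f x + D (y - x)))) \<longlongrightarrow> 0) (at x within Rp p)"
    using D by (simp add: has_derivative_within)
  then have "((\<lambda>y. (1 / norm (y - x)) *\<^sub>R (f y - (f x + inner g (y - x)))) \<longlongrightarrow> 0) (at x within Rp p)"
    by (rule Lim_transform_eventually) (use assms(2) in \<open>auto simp: eventually_at_filter D_eq\<close>)
  moreover have "g \<in> Rp p"
    by (auto simp: g_def intro!: sum_in_Rp)
  ultimately show ?thesis
    by (auto simp: has_derivative_within bounded_linear_inner_right)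
qed

text \<open>A line with direction in \<open>Rp p\<close> never leaves \<open>Rp p\<close>, so the
  derivative within the subspace becomes an ordinary derivative in one real variable.\<close>

lemma has_derivative_along_line:
  assumes "x \<in> Rp p" "d \<in> Rp p" "(f has_derivative inner g) (at (x + t *\<^sub>R d) within Rp p)"
  shows "((\<lambda>t. f (x + t *\<^sub>R d)) has_real_derivative inner g d) (at t)"
proof -
  have "((\<lambda>t. x + t *\<^sub>R d) has_derivative (\<lambda>h. h *\<^sub>R d)) (at t)"
    by (auto intro!: derivative_eq_intros)
  moreover have "(f has_derivative inner g) (at (x + t *\<^sub>R d) within range (\<lambda>t. x + t *\<^sub>R d))"
    by (rule has_derivative_subset[OF assms(3)]) (use assms(1,2) in auto)
  ultimately have "((\<lambda>t. f (x + t *\<^sub>R d)) has_derivative (\<lambda>h. inner g (h *\<^sub>R d))) (at t)"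
    by (rule has_derivative_in_compose)
  then show ?thesis
    by (simp add: has_field_derivative_def mult.commute[of _ "inner g d"])
qed

text \<open>Makes the \<open>THE\<close> in \<open>grad\<close> usable: two candidates
  \<open>g\<close> and \<open>h\<close> give the same derivative along \<open>g - h\<close>, so this
  direction has length 0.\<close>

lemma grad_eqI:
  assumes "x \<in> Rp p" "g \<in> Rp p" "(f has_derivative inner g) (at x within Rp p)"
  shows "grad p f x = g"
  unfolding grad_def
proof (rule the_equality)
  fix h assume h: "h \<in> Rp p \<and> (f has_derivative inner h) (at x within Rp p)"
  have "((\<lambda>t. f (x + t *\<^sub>R (g - h))) has_real_derivative inner g (g - h)) (at 0)"
       "((\<lambda>t. f (x + t *\<^sub>R (g - h))) has_real_derivative inner h (g - h)) (at 0)"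
    using assms h by (auto intro!: has_derivative_along_line[of x p])
  then have "inner (g - h) (g - h) = 0"
    using DERIV_unique by (fastforce simp: inner_diff_left)
  then show "h = g"
    by simp
qed (use assms in simp)

lemma grad_props:
  assumes "f differentiable_on Rp p" "x \<in> Rp p"
  shows "grad p f x \<in> Rp p" "(f has_derivative inner (grad p f x)) (at x within Rp p)"
proof -
  obtain g where g: "g \<in> Rp p" "(f has_derivative inner g) (at x within Rp p)"
    using grad_exists assms unfolding differentiable_on_def by blast
  then have "grad p f x = g"
    using assms(2) by (intro grad_eqI)
  with g show "grad p f x \<in> Rp p" "(f has_derivative inner (grad p f x)) (at x within Rp p)"
    by simp_all
qed

locale smooth_convex =
  fixes p :: nat and f :: "fvec \<Rightarrow> real" and L :: real
  assumes convex: "convex_on (Rp p) f"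
    and differentiable: "f differentiable_on Rp p"
    and L_pos: "0 < L"
    and lipschitz: "L-lipschitz_on (Rp p) (grad p f)"
begin

lemma grad_in_Rp [simp]: "x \<in> Rp p \<Longrightarrow> grad p f x \<in> Rp p"
  by (rule grad_props[OF differentiable])

lemma line_derivative:
  assumes "x \<in> Rp p" "d \<in> Rp p"
  shows "((\<lambda>t. f (x + t *\<^sub>R d)) has_real_derivative inner (grad p f (x + t *\<^sub>R d)) d) (at t)"
  by (rule has_derivative_along_line[OF assms grad_props(2)[OF differentiable]]) (simp add: assms)

lemma tangent_le:
  assumes "x \<in> Rp p" "y \<in> Rp p"
  shows "f x + inner (grad p f x) (y - x) \<le> f y"
proof -
  let ?\<phi> = "\<lambda>t. f (x + t *\<^sub>R (y - x))"
  have "convex_on UNIV ?\<phi>"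
  proof (rule convex_onI)
    fix t a b :: real assume "0 < t" "t < 1"
    have "x + ((1 - t) *\<^sub>R a + t *\<^sub>R b) *\<^sub>R (y - x)
        = (1 - t) *\<^sub>R (x + a *\<^sub>R (y - x)) + t *\<^sub>R (x + b *\<^sub>R (y - x))"
      by (simp add: algebra_simps)
    then show "?\<phi> ((1 - t) *\<^sub>R a + t *\<^sub>R b) \<le> (1 - t) * ?\<phi> a + t * ?\<phi> b"
      using convex_onD[OF convex, of t "x + a *\<^sub>R (y - x)" "x + b *\<^sub>R (y - x)"] assms
        \<open>0 < t\<close> \<open>t < 1\<close> by simp
  qed simp
  then have "?\<phi> 1 - ?\<phi> 0 \<ge> inner (grad p f (x + 0 *\<^sub>R (y - x))) (y - x) * (1 - 0)"
    by (rule convex_on_imp_above_tangent) (use line_derivative[of x "y - x" 0] assms in auto)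
  then show ?thesis
    by simp
qed

lemma descent:
  assumes "x \<in> Rp p" "y \<in> Rp p"
  shows "f y \<le> f x + inner (grad p f x) (y - x) + L / 2 * (norm (y - x))\<^sup>2"
proof -
  define d where "d = y - x"
  have d: "d \<in> Rp p"
    using assms by (simp add: d_def)
  \<comment> \<open>Quadratic model minus \<open>f\<close> along the segment; it is nondecreasing
    because the gradient changes by at most \<open>L * t * norm d\<close>.\<close>
  let ?h = "\<lambda>t. t * inner (grad p f x) d + L / 2 * t\<^sup>2 * (norm d)\<^sup>2 - f (x + t *\<^sub>R d)"
  let ?h' = "\<lambda>t. inner (grad p f x) d + L * t * (norm d)\<^sup>2 - inner (grad p f (x + t *\<^sub>R d)) d"
  have deriv: "(?h has_real_derivative ?h' t) (at t)" for t
    using line_derivative[OF assms(1) d, of t] by (auto intro!: derivative_eq_intros)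
  have deriv_nonneg: "?h' t \<ge> 0" if "0 \<le> t" for t
  proof -
    have "inner (grad p f (x + t *\<^sub>R d) - grad p f x) d \<le> norm (grad p f (x + t *\<^sub>R d) - grad p f x) * norm d"
      by (rule norm_cauchy_schwarz)
    also have "norm (grad p f (x + t *\<^sub>R d) - grad p f x) \<le> L * norm ((x + t *\<^sub>R d) - x)"
      using lipschitz assms d by (intro lipschitz_on_normD[of L "Rp p"]) auto
    finally show ?thesis
      using that by (simp add: inner_diff_left power2_eq_square mult_right_mono)
  qed
  have "?h 0 \<le> ?h 1"
  proof (rule DERIV_nonneg_imp_nondecreasing[where f = ?h and a = 0 and b = 1])
    fix t :: real assume "0 \<le> t"
    show "\<exists>y. (?h has_real_derivative y) (at t) \<and> y \<ge> 0"
      by (rule exI[of _ "?h' t"], rule conjI[OF deriv deriv_nonneg[OF \<open>0 \<le> t\<close>]])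
  qed simp
  moreover have "x + 1 *\<^sub>R d = y"
    by (simp add: d_def)
  ultimately have "f y \<le> f x + inner (grad p f x) d + L / 2 * (norm d)\<^sup>2"
    by simp
  then show ?thesis
    by (simp only: d_def)
qed

text \<open>Compare the upper bound from \<^term>\<open>y\<close> with the tangent at \<^term>\<open>x\<close>, both evaluated at the
  point reached from \<^term>\<open>y\<close> by a gradient step for \<^term>\<open>\<lambda>z. f z - inner (grad p f x) z\<close>.\<close>

lemma tangent_gap:
  assumes "x \<in> Rp p" "y \<in> Rp p"
  shows "f x + inner (grad p f x) (y - x) + (norm (grad p f y - grad p f x))\<^sup>2 / (2 * L) \<le> f y"
proof -
  define g where "g = grad p f y - grad p f x"
  define z where "z = y - (1 / L) *\<^sub>R g"
  have z: "z \<in> Rp p"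
    using assms by (simp add: z_def g_def)
  have "f x + inner (grad p f x) (z - x) \<le> f y + inner (grad p f y) (z - y) + L / 2 * (norm (z - y))\<^sup>2"
    using tangent_le[OF assms(1) z] descent[OF assms(2) z] by linarith
  moreover have "inner (grad p f x) (z - x) = inner (grad p f x) (y - x) - inner (grad p f x) g / L"
    by (simp add: z_def inner_diff_right)
  moreover have "inner (grad p f y) (z - y) = - inner (grad p f y) g / L"
    by (simp add: z_def)
  moreover have "L / 2 * (norm (z - y))\<^sup>2 = (norm g)\<^sup>2 / (2 * L)"
    using L_pos by (simp add: z_def power_mult_distrib power_divide power2_eq_square)
  moreover have "inner (grad p f y) g / L - inner (grad p f x) g / L = (norm g)\<^sup>2 / L"
    by (simp add: g_def power2_norm_eq_inner inner_diff_left diff_divide_distrib)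
  ultimately have "f x + inner (grad p f x) (y - x) + (norm g)\<^sup>2 / L \<le> f y + (norm g)\<^sup>2 / (2 * L)"
    by linarith
  moreover have "(norm g)\<^sup>2 / L = 2 * ((norm g)\<^sup>2 / (2 * L))"
    by simp
  ultimately show ?thesis
    unfolding g_def by linarith
qed

text \<open>Add two instances of \<open>tangent_gap\<close> with the points exchanged: the function
  values cancel.\<close>

lemma cocoercive:
  assumes "x \<in> Rp p" "y \<in> Rp p"
  shows "(norm (grad p f x - grad p f y))\<^sup>2 / L \<le> inner (grad p f x - grad p f y) (x - y)"
proof -
  let ?G = "(norm (grad p f x - grad p f y))\<^sup>2 / (2 * L)"
  have "inner (grad p f x) (y - x) + inner (grad p f y) (x - y) + ?G + ?G \<le> 0"
    using tangent_gap[OF assms] tangent_gap[OF assms(2,1)]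
    by (simp add: norm_minus_commute[of "grad p f y"])
  moreover have "inner (grad p f x) (y - x) + inner (grad p f y) (x - y)
      = - inner (grad p f x - grad p f y) (x - y)"
    by (simp add: inner_diff_left inner_diff_right)
  moreover have "(norm (grad p f x - grad p f y))\<^sup>2 / L = ?G + ?G"
    by simp
  ultimately show ?thesis
    by linarith
qed

text \<open>A gradient step with stepsize \<open>1 / L\<close> lowers \<open>f\<close> by at least
  \<open>(norm (grad p f x))\<^sup>2 / (2 * L)\<close> and cannot pass below \<open>m\<close>. Used
  with the infimum of each agent, and with \<open>m = f x\<close> at a minimizer.\<close>

lemma norm_grad_sq_le:
  assumes "x \<in> Rp p" and lower: "\<And>y. y \<in> Rp p \<Longrightarrow> m \<le> f y"
  shows "(norm (grad p f x))\<^sup>2 \<le> 2 * L * (f x - m)"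
proof -
  let ?y = "x - (1 / L) *\<^sub>R grad p f x"
  have "m \<le> f ?y"
    using assms by (intro lower) simp
  also have "\<dots> \<le> f x + inner (grad p f x) (?y - x) + L / 2 * (norm (?y - x))\<^sup>2"
    using assms(1) by (intro descent) auto
  also have "\<dots> = f x - (norm (grad p f x))\<^sup>2 / (2 * L)"
    using L_pos by (simp add: power2_norm_eq_inner[symmetric] power_mult_distrib power_divide field_simps power2_eq_square)
  finally show ?thesis
    using L_pos by (simp add: field_simps)
qed

lemma grad_minimizer:
  assumes "x \<in> minimizers p f"
  shows "grad p f x = 0"
proof -
  have "(norm (grad p f x))\<^sup>2 \<le> 2 * L * (f x - f x)"
    using assms by (intro norm_grad_sq_le) (auto simp: minimizers_def)
  then show ?thesis
    by simp
qed

lemma closed_minimizers: "closed (minimizers p f)"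
proof -
  have "continuous_on (Rp p) f"
    by (rule differentiable_imp_continuous_on[OF differentiable])
  then have "closed {x \<in> Rp p. f x \<le> f y}" for y
    using continuous_on_closed_Collect_le[OF _ continuous_on_const closed_Rp] by blast
  moreover have "minimizers p f = Rp p \<inter> (\<Inter>y\<in>Rp p. {x \<in> Rp p. f x \<le> f y})"
    by (auto simp: minimizers_def)
  ultimately show ?thesis
    by (auto intro!: closed_Int closed_INT closed_Rp)
qed

end

text \<open>The constant is the sum of the individual ones, that is, \<open>n\<close> times
  \<open>Lbar\<close>; this is how \<open>Lbar\<close> comes to govern the smoothness of the
  averaged objective.\<close>

lemma
  assumes "finite I" "I \<noteq> {}" and smooth: "\<And>i. i \<in> I \<Longrightarrow> smooth_convex p (f i) (L i)"
  shows grad_sum: "x \<in> Rp p \<Longrightarrow> grad p (\<lambda>x. \<Sum>i\<in>I. f i x) x = (\<Sum>i\<in>I. grad p (f i) x)"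
    and smooth_convex_sum: "smooth_convex p (\<lambda>x. \<Sum>i\<in>I. f i x) (\<Sum>i\<in>I. L i)"
proof -
  have deriv: "((\<lambda>x. \<Sum>i\<in>I. f i x) has_derivative inner (\<Sum>i\<in>I. grad p (f i) x)) (at x within Rp p)"
    if "x \<in> Rp p" for x
  proof -
    have "((\<lambda>x. \<Sum>i\<in>I. f i x) has_derivative (\<lambda>h. \<Sum>i\<in>I. inner (grad p (f i) x) h)) (at x within Rp p)"
      using that smooth by (intro has_derivative_sum grad_props(2) smooth_convex.differentiable)
    moreover have "inner (\<Sum>i\<in>I. grad p (f i) x) = (\<lambda>h. \<Sum>i\<in>I. inner (grad p (f i) x) h)"
      by (simp add: fun_eq_iff inner_sum_left)
    ultimately show ?thesis
      by simp
  qed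
  have grad_eq: "grad p (\<lambda>x. \<Sum>i\<in>I. f i x) x = (\<Sum>i\<in>I. grad p (f i) x)" if "x \<in> Rp p" for x
    using that by (intro grad_eqI deriv sum_in_Rp smooth_convex.grad_in_Rp[OF smooth])
  then show "x \<in> Rp p \<Longrightarrow> grad p (\<lambda>x. \<Sum>i\<in>I. f i x) x = (\<Sum>i\<in>I. grad p (f i) x)" .
  show "smooth_convex p (\<lambda>x. \<Sum>i\<in>I. f i x) (\<Sum>i\<in>I. L i)"
  proof
    have "convex_on (Rp p) (\<lambda>x. \<Sum>i\<in>J. f i x)" if "J \<subseteq> I" for J
      using finite_subset[OF that assms(1)] that
      by (induction J rule: finite_induct)
        (auto simp: convex_on_const convex_Rp intro!: convex_on_add smooth_convex.convex[OF smooth])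
    then show "convex_on (Rp p) (\<lambda>x. \<Sum>i\<in>I. f i x)"
      by simp
    show "(\<lambda>x. \<Sum>i\<in>I. f i x) differentiable_on Rp p"
      using deriv unfolding differentiable_on_def differentiable_def by blast
    show "0 < (\<Sum>i\<in>I. L i)"
      using assms by (intro sum_pos smooth_convex.L_pos[OF smooth]) auto
    show "(\<Sum>i\<in>I. L i)-lipschitz_on (Rp p) (grad p (\<lambda>x. \<Sum>i\<in>I. f i x))"
    proof (rule lipschitz_onI)
      fix x y assume xy: "x \<in> Rp p" "y \<in> Rp p"
      have "dist (grad p (f i) x) (grad p (f i) y) \<le> L i * dist x y" if "i \<in> I" for i
        using lipschitz_onD[OF smooth_convex.lipschitz[OF smooth[OF that]] xy] .
      then show "dist (grad p (\<lambda>x. \<Sum>i\<in>I. f i x) x) (grad p (\<lambda>x. \<Sum>i\<in>I. f i x) y) \<le> (\<Sum>i\<in>I. L i) * dist x y"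
        unfolding grad_eq[OF xy(1)] grad_eq[OF xy(2)] dist_norm sum_subtractf[symmetric] sum_distrib_right
        by (intro sum_norm_le)
    qed (use \<open>0 < (\<Sum>i\<in>I. L i)\<close> in simp)
  qed
qed

section \<open>Spectra of symmetric stochastic matrices\<close>

text \<open>A maximizer of the Rayleigh quotient on the unit sphere of \<open>S\<close> is an
  eigenvector, with the maximum as eigenvalue. Applied to \<open>- W\<close>, and to
  \<open>W\<close> composed with itself orthogonally to the constant vectors.\<close>

lemma self_adjoint_maximal_eigenvector:
  fixes T :: "'a::real_inner \<Rightarrow> 'a"
  assumes S: "subspace S" and compact: "compact (S \<inter> sphere 0 1)" and nontrivial: "x\<^sub>0 \<in> S" "x\<^sub>0 \<noteq> 0"
    and T: "linear T" "T ` S \<subseteq> S" "continuous_on S T"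
    and self_adjoint: "\<And>x y. x \<in> S \<Longrightarrow> y \<in> S \<Longrightarrow> inner (T x) y = inner x (T y)"
  obtains v m where "v \<in> S" "v \<noteq> 0" "T v = m *\<^sub>R v" "\<And>x. x \<in> S \<Longrightarrow> inner (T x) x \<le> m * (norm x)\<^sup>2"
proof -
  let ?q = "\<lambda>x. inner (T x) x"
  have "sgn x\<^sub>0 \<in> S \<inter> sphere 0 1"
    using nontrivial S by (auto simp: sgn_div_norm subspace_scale)
  moreover have "continuous_on (S \<inter> sphere 0 1) ?q"
    by (intro continuous_intros continuous_on_subset[OF T(3)]) auto
  ultimately have "\<exists>v \<in> S \<inter> sphere 0 1. \<forall>x \<in> S \<inter> sphere 0 1. ?q x \<le> ?q v"
    by (intro continuous_attains_sup compact) auto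
  then obtain v where v: "v \<in> S" "norm v = 1" and max: "\<And>x. x \<in> S \<Longrightarrow> norm x = 1 \<Longrightarrow> ?q x \<le> ?q v"
    by (auto simp: dist_norm)
  define m where "m = ?q v"
  have bound: "?q x \<le> m * (norm x)\<^sup>2" if x: "x \<in> S" for x
  proof (cases "x = 0")
    case False
    have "?q (sgn x) \<le> m"
      unfolding m_def using False x S by (intro max) (auto simp: sgn_div_norm subspace_scale norm_sgn)
    moreover have "?q (sgn x) = ?q x / (norm x)\<^sup>2"
      by (simp add: sgn_div_norm linear_scale[OF T(1)] power2_eq_square divide_inverse)
    ultimately show ?thesis
      using False by (simp add: pos_divide_le_eq)
  qed (simp add: linear_0[OF T(1)])
  define w where "w = m *\<^sub>R v - T v"
  have w: "w \<in> S"
    using v T(2) S by (auto simp: w_def subspace_diff subspace_scale)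
  \<comment> \<open>\<open>m * (norm x)\<^sup>2 - ?q x\<close> is nonnegative on \<open>S\<close>
    and vanishes at \<open>v\<close>; at \<open>v + t *\<^sub>R w\<close> it equals
    \<open>2 * t * a + t\<^sup>2 * b\<close>. With the residual \<open>w\<close> as direction, the
    slope measures how far \<open>v\<close> is from being an eigenvector.\<close>
  define a b where "a = inner w w" and "b = m * (norm w)\<^sup>2 - ?q w"
  have first_order: "0 \<le> 2 * t * a + t\<^sup>2 * b" for t
  proof -
    have le: "?q (v + t *\<^sub>R w) \<le> m * (norm (v + t *\<^sub>R w))\<^sup>2"
      using v w S by (intro bound) (auto simp: subspace_add subspace_scale)
    have q: "?q (v + t *\<^sub>R w) = m + 2 * t * inner (T v) w + t\<^sup>2 * ?q w"
      using self_adjoint[OF w v(1)]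
      by (simp add: linear_add[OF T(1)] linear_scale[OF T(1)] inner_add m_def power2_eq_square
          inner_commute[of w] inner_commute[of v] algebra_simps)
    have n: "(norm (v + t *\<^sub>R w))\<^sup>2 = 1 + 2 * t * inner v w + t\<^sup>2 * (norm w)\<^sup>2"
      unfolding power2_norm_eq_inner
      by (simp only: inner_add_left inner_add_right inner_scaleR_left inner_scaleR_right
          inner_commute[of w v] v(2)[unfolded norm_eq_1])
        (simp add: algebra_simps power2_eq_square)
    have "a = inner (m *\<^sub>R v - T v) w"
      by (simp only: a_def w_def)
    then have a: "a = m * inner v w - inner (T v) w"
      by (simp add: inner_diff_left)
    show ?thesis
      using le unfolding q n a b_def by (simp add: algebra_simps)
  qed
  have "b \<ge> 0"
    unfolding b_def using bound[OF w] by simp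
  have "a = 0"
  proof (rule ccontr)
    assume "a \<noteq> 0"
    \<comment> \<open>The vertex of the parabola would be \<open>- a / b\<close>;
      \<open>b + 1\<close> avoids a zero denominator and still gives a negative value.\<close>
    let ?t = "- a / (b + 1)"
    have "2 * ?t * a + ?t\<^sup>2 * b = - (a\<^sup>2 * (b + 2)) / (b + 1)\<^sup>2"
      using \<open>b \<ge> 0\<close> by (simp add: divide_simps) (simp add: power2_eq_square algebra_simps)
    also have "\<dots> < 0"
      using \<open>a \<noteq> 0\<close> \<open>b \<ge> 0\<close> by (simp add: divide_neg_pos)
    finally show False
      using first_order[of ?t] by simp
  qed
  then have "T v = m *\<^sub>R v"
    by (simp add: a_def w_def)
  with v bound show ?thesis
    by (intro that[of v m]) auto
qed

text \<open>\<open>P\<close> is the identity with columns \<open>a\<close> and \<open>b\<close>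
  replaced by \<open>u\<close> and \<open>v\<close>. Multiplying the characteristic matrix by
  \<open>P\<close> makes these two columns multiples of \<open>[:- k, 1:]\<close>; that factor is
  split off as the diagonal matrix \<open>E\<close>, with \<open>N\<close> remaining. The minor
  makes \<open>P\<close> invertible, so comparing determinants gives the square.\<close>

lemma char_poly_double_root:
  fixes A :: "'a::field mat"
  assumes A: "A \<in> carrier_mat n n" and u: "u \<in> carrier_vec n" and v: "v \<in> carrier_vec n"
    and eig: "A *\<^sub>v u = k \<cdot>\<^sub>v u" "A *\<^sub>v v = k \<cdot>\<^sub>v v"
    and ab: "a < n" "b < n" and minor: "u $ a * v $ b \<noteq> u $ b * v $ a"
  shows "[:- k, 1:]\<^sup>2 dvd char_poly A"
proof -
  have "a \<noteq> b"
    using minor by auto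
  let ?\<iota> = "\<lambda>x::'a. [:x:]"
  interpret const_hom: comm_ring_hom ?\<iota>
    by unfold_locales (auto simp: one_pCons)
  let ?C = "char_poly_matrix A"
  define P where "P = mat n n (\<lambda>(i, j). if j = a then u $ i else if j = b then v $ i else of_bool (i = j))"
  define N where "N = mat n n (\<lambda>(i, j). if j = a then [:u $ i:] else if j = b then [:v $ i:] else ?C $$ (i, j))"
  define E where "E = mat n n (\<lambda>(i, j). if i \<noteq> j then 0 else if j = a \<or> j = b then [:- k, 1:] else 1)"
  have carriers: "P \<in> carrier_mat n n" "N \<in> carrier_mat n n" "E \<in> carrier_mat n n" "?C \<in> carrier_mat n n"
    using A by (auto simp: P_def N_def E_def)
  have C_index: "?C $$ (i, l) = (if i = l then [:0, 1:] else 0) - [:A $$ (i, l):]" if "i < n" "l < n" for i l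
    using that A by (auto simp: char_poly_matrix_def)
  have C_eigen: "(\<Sum>l<n. ?C $$ (i, l) * [:w $ l:]) = [:w $ i:] * [:- k, 1:]"
    if "i < n" "w \<in> carrier_vec n" "A *\<^sub>v w = k \<cdot>\<^sub>v w" for i w
  proof -
    have "(\<Sum>l<n. A $$ (i, l) * w $ l) = (A *\<^sub>v w) $ i"
      using that(1,2) A by (auto simp: scalar_prod_def atLeast0LessThan intro!: sum.cong)
    also have "\<dots> = k * w $ i"
      using that by auto
    finally have "(\<Sum>l<n. [:A $$ (i, l):] * [:w $ l:]) = [:k * w $ i:]"
      by (simp add: mult.commute flip: const_hom.hom_sum)
    moreover have "(\<Sum>l<n. ?C $$ (i, l) * [:w $ l:])
        = (\<Sum>l<n. (if i = l then [:0, 1:] * [:w $ l:] else 0) - [:A $$ (i, l):] * [:w $ l:])"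
      using that by (intro sum.cong) (auto simp: C_index left_diff_distrib simp del: mult_pCons_left mult_pCons_right)
    ultimately show ?thesis
      using that by (simp add: sum_subtractf)
  qed
  have "?C * map_mat ?\<iota> P = N * E"
  proof (rule eq_matI)
    fix i j assume "i < dim_row (N * E)" "j < dim_col (N * E)"
    then have ij: "i < n" "j < n"
      using carriers by auto
    have "(?C * map_mat ?\<iota> P) $$ (i, j) = (\<Sum>l<n. ?C $$ (i, l) * [:P $$ (l, j):])"
      using carriers ij by (auto simp: scalar_prod_def atLeast0LessThan intro!: sum.cong)
    also have "\<dots> = N $$ (i, j) * E $$ (j, j)"
    proof -
      consider "j = a" | "j = b" | "j \<noteq> a" "j \<noteq> b"
        by blast
      then show ?thesis
      proof cases
        case 1
        then show ?thesis
          using C_eigen[OF ij(1) u eig(1)] ij by (simp add: P_def N_def E_def del: mult_pCons_left mult_pCons_right)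
      next
        case 2
        then show ?thesis
          using C_eigen[OF ij(1) v eig(2)] ij \<open>a \<noteq> b\<close>
          by (simp add: P_def N_def E_def del: mult_pCons_left mult_pCons_right)
      next
        case 3
        have "(\<Sum>l<n. ?C $$ (i, l) * [:P $$ (l, j):]) = (\<Sum>l<n. if l = j then ?C $$ (i, l) else 0)"
          using 3 ij by (intro sum.cong) (auto simp: P_def)
        with 3 ij show ?thesis
          by (simp add: N_def E_def)
      qed
    qed
    also have "\<dots> = (\<Sum>l<n. if l = j then N $$ (i, l) * E $$ (l, j) else 0)"
      using ij by simp
    also have "\<dots> = (\<Sum>l<n. N $$ (i, l) * E $$ (l, j))"
      using ij by (intro sum.cong) (auto simp: E_def)
    also have "\<dots> = (N * E) $$ (i, j)"
      using carriers ij by (auto simp: scalar_prod_def atLeast0LessThan intro!: sum.cong)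
    finally show "(?C * map_mat ?\<iota> P) $$ (i, j) = (N * E) $$ (i, j)" .
  qed (use carriers in auto)
  then have "det (?C * map_mat ?\<iota> P) = det (N * E)"
    by simp
  then have "char_poly A * [:det P:] = det N * det E"
    using carriers by (simp add: det_mult[of _ n] char_poly_def del: mult_pCons_right)
  also have "det E = [:- k, 1:]\<^sup>2"
  proof -
    have "det E = prod_list (diag_mat E)"
      by (rule det_upper_triangular[OF _ carriers(3)]) (auto simp: E_def)
    also have "\<dots> = (\<Prod>j<n. if j \<in> {a, b} then [:- k, 1:] else 1)"
      using carriers by (simp add: prod_list_diag_prod E_def atLeast0LessThan)
    also have "\<dots> = (\<Prod>j\<in>{a, b}. [:- k, 1:])"
      using ab by (subst prod.inter_restrict[symmetric]) (auto intro!: prod.cong)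
    also have "\<dots> = [:- k, 1:]\<^sup>2"
      using \<open>a \<noteq> b\<close> by (simp add: power2_eq_square)
    finally show ?thesis .
  qed
  finally have "char_poly A * [:det P:] = det N * [:- k, 1:]\<^sup>2" .
  moreover have "char_poly A * [:det P:] = Polynomial.smult (det P) (char_poly A)"
    by simp
  ultimately have "[:- k, 1:]\<^sup>2 dvd Polynomial.smult (det P) (char_poly A)"
    by (metis dvd_triv_right)
  \<comment> \<open>For a kernel vector, rows \<open>a\<close> and \<open>b\<close> form a 2 by 2
    system with nonzero determinant, solved by Cramer's rule; every other row then leaves only its
    own entry.\<close>
  moreover have "det P \<noteq> 0"
  proof
    assume "det P = 0"
    then obtain y where y: "y \<in> carrier_vec n" "y \<noteq> 0\<^sub>v n" "P *\<^sub>v y = 0\<^sub>v n"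
      using det_0_iff_vec_prod_zero[OF carriers(1)] by blast
    have row: "u $ i * y $ a + v $ i * y $ b + (if i = a \<or> i = b then 0 else y $ i) = 0" if i: "i < n" for i
    proof -
      have "0 = (P *\<^sub>v y) $ i"
        using y i by simp
      also have "\<dots> = (\<Sum>j<n. P $$ (i, j) * y $ j)"
        using y(1) i carriers by (auto simp: scalar_prod_def atLeast0LessThan intro!: sum.cong)
      also have "\<dots> = (\<Sum>j<n. (if j = a then u $ i * y $ a else 0) + (if j = b then v $ i * y $ b else 0)
          + (if j = i then (if i = a \<or> i = b then 0 else y $ i) else 0))"
        using i \<open>a \<noteq> b\<close> by (intro sum.cong) (auto simp: P_def)
      also have "\<dots> = u $ i * y $ a + v $ i * y $ b + (if i = a \<or> i = b then 0 else y $ i)"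
        using i ab by (simp add: sum.distrib)
      finally show ?thesis
        by simp
    qed
    have rows: "u $ a * y $ a + v $ a * y $ b = 0" "u $ b * y $ a + v $ b * y $ b = 0"
      using row[OF ab(1)] row[OF ab(2)] by simp_all
    have "(u $ a * v $ b - u $ b * v $ a) * y $ a
        = v $ b * (u $ a * y $ a + v $ a * y $ b) - v $ a * (u $ b * y $ a + v $ b * y $ b)"
      "(u $ a * v $ b - u $ b * v $ a) * y $ b
        = u $ a * (u $ b * y $ a + v $ b * y $ b) - u $ b * (u $ a * y $ a + v $ a * y $ b)"
      by (simp_all add: algebra_simps)
    then have "(u $ a * v $ b - u $ b * v $ a) * y $ a = 0" "(u $ a * v $ b - u $ b * v $ a) * y $ b = 0"
      unfolding rows by (simp_all only: mult_zero_right diff_zero)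
    with minor have "y $ a = 0" "y $ b = 0"
      by simp_all
    then have "y $ i = 0" if "i < n" for i
      using row[OF that] by (auto split: if_splits)
    with y show False
      by auto
  qed
  ultimately show ?thesis
    by (simp add: dvd_smult_iff)
qed

section \<open>Real spectrum of symmetric matrices\<close>

lemma eigenvalue_symmetric_real:
  fixes W :: "real mat"
  assumes W: "W \<in> carrier_mat n n" "transpose_mat W = W"
    and ev: "eigenvalue (map_mat complex_of_real W) z"
  shows "z \<in> \<real>"
proof -
  obtain v where v: "v \<in> carrier_vec n" "v \<noteq> 0\<^sub>v n" "map_mat complex_of_real W *\<^sub>v v = z \<cdot>\<^sub>v v"
    using ev W by (auto simp: eigenvalue_def eigenvector_def)
  have sym: "W $$ (i, j) = W $$ (j, i)" if "i < n" "j < n" for i j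
    using W that by (metis index_transpose_mat(1) carrier_matD)
  have row: "(\<Sum>j<n. complex_of_real (W $$ (i, j)) * v $ j) = z * v $ i" if "i < n" for i
  proof -
    have "(\<Sum>j<n. complex_of_real (W $$ (i, j)) * v $ j) = (map_mat complex_of_real W *\<^sub>v v) $ i"
      using v(1) W that by (auto simp: scalar_prod_def atLeast0LessThan intro!: sum.cong)
    then show ?thesis
      using v that by simp
  qed
  define s where "s = (\<Sum>i<n. (cmod (v $ i))\<^sup>2)"
  \<comment> \<open>The Hermitian form at \<open>v\<close>: it equals \<open>z\<close> times the
    positive number \<open>s\<close> and, \<open>W\<close> being real and symmetric, is its own
    conjugate.\<close>
  define q where "q = (\<Sum>i<n. cnj (v $ i) * (\<Sum>j<n. complex_of_real (W $$ (i, j)) * v $ j))"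
  have "q = (\<Sum>i<n. z * (v $ i * cnj (v $ i)))"
    unfolding q_def by (intro sum.cong) (auto simp: row)
  also have "\<dots> = z * of_real s"
    by (simp only: s_def of_real_sum complex_norm_square sum_distrib_left)
  finally have q: "q = z * of_real s" .
  have "cnj q = (\<Sum>i<n. \<Sum>j<n. complex_of_real (W $$ (i, j)) * v $ i * cnj (v $ j))"
    unfolding q_def by (simp add: sum_distrib_left ac_simps)
  also have "\<dots> = (\<Sum>j<n. \<Sum>i<n. complex_of_real (W $$ (i, j)) * v $ i * cnj (v $ j))"
    by (rule sum.swap)
  also have "\<dots> = q"
    unfolding q_def sum_distrib_left by (intro sum.cong refl) (auto simp: sym ac_simps)
  finally have "cnj z * of_real s = z * of_real s"
    unfolding q by simp
  moreover have "s > 0"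
  proof -
    obtain i where "i < n" "v $ i \<noteq> 0"
      using v(1,2) by (auto simp: vec_eq_iff)
    then show ?thesis
      unfolding s_def by (intro sum_pos2[of _ i]) auto
  qed
  ultimately show ?thesis
    by (simp add: Reals_cnj_iff)
qed

text \<open>Over the complex numbers there are \<open>n\<close> linear factors; their roots are
  real, so the factorization descends to the reals. This count gives the list positions in
  \<open>eigval\<close> their meaning.\<close>

lemma size_proots_char_poly_symmetric:
  fixes W :: "real mat"
  assumes W: "W \<in> carrier_mat n n" "transpose_mat W = W"
  shows "size (proots (char_poly W)) = n"
proof -
  interpret of_real_poly: map_poly_comm_ring_hom complex_of_real ..
  let ?W = "map_mat complex_of_real W"
  have W': "?W \<in> carrier_mat n n"
    using W by simp
  obtain zs where zs: "char_poly ?W = (\<Prod>z\<leftarrow>zs. [:- z, 1:])" "length zs = n"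
    using char_poly_factorized[OF W'] by blast
  have real: "of_real (Re z) = z" if "z \<in> set zs" for z
  proof -
    have "poly (char_poly ?W) z = 0"
      unfolding zs using that by (auto simp: poly_prod_list prod_list_zero_iff)
    then show ?thesis
      using eigenvalue_symmetric_real[OF W] eigenvalue_root_char_poly[OF W'] by (simp add: of_real_Re)
  qed
  have "map_poly complex_of_real (char_poly W) = (\<Prod>z\<leftarrow>zs. [:- z, 1:])"
    using of_real_hom.char_poly_hom[OF W(1)] zs(1) by metis
  also have "\<dots> = (\<Prod>z\<leftarrow>zs. map_poly complex_of_real [:- Re z, 1:])"
    by (intro arg_cong[of _ _ prod_list] map_cong) (auto simp: real hom_distribs)
  also have "\<dots> = map_poly complex_of_real (\<Prod>z\<leftarrow>zs. [:- Re z, 1:])"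
    by (induction zs) (simp_all add: of_real_poly.hom_mult hom_distribs del: mult_pCons_left)
  finally have "char_poly W = (\<Prod>z\<leftarrow>zs. [:- Re z, 1:])"
    by (simp add: poly_eq_iff)
  moreover have "0 \<notin> set (map (\<lambda>z. [:- Re z, 1:]) zs)"
    by auto
  ultimately have "proots (char_poly W) = (\<Sum>z\<leftarrow>zs. {#Re z#})"
    using proots_prod_list[of "map (\<lambda>z. [:- Re z, 1:]) zs"] by (simp add: o_def)
  moreover have "size (\<Sum>z\<leftarrow>zs. {#Re z#}) = length zs"
    by (induction zs) simp_all
  ultimately show ?thesis
    using zs(2) by simp
qed

lemma char_poly_nonzero: "A \<in> carrier_mat n n \<Longrightarrow> char_poly A \<noteq> 0"
  using degree_monic_char_poly[of A n] by auto

section \<open>Real matrices as operators on coordinate spaces\<close>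

lemma compact_sphere_Rp:
  assumes "closed S"
  shows "compact (Rp n \<inter> S \<inter> sphere 0 1)"
proof (rule compact_subset_Rp)
  have "closed (sphere 0 1 :: fvec set)"
    unfolding sphere_def by (intro closed_Collect_eq continuous_intros)
  then show "closed (Rp n \<inter> S \<inter> sphere 0 1)"
    by (intro closed_Int closed_Rp assms)
  show "bounded (Rp n \<inter> S \<inter> sphere 0 1)"
    by (rule bounded_subset[OF bounded_cball[of 0 1]]) auto
qed auto

text \<open>Lets \<open>W\<close> act on vectors of the same type as the agents' states, so that
  compactness in \<open>Rp n\<close> also serves the spectral theory.\<close>

definition mat_op :: "nat \<Rightarrow> real mat \<Rightarrow> fvec \<Rightarrow> fvec" where
  "mat_op n W x = (\<Sum>i<n. (\<Sum>j<n. W $$ (i, j) * coord x j) *\<^sub>R unit_fvec i)"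

lemma coord_mat_op: "coord (mat_op n W x) i = (if i < n then \<Sum>j<n. W $$ (i, j) * coord x j else 0)"
  by (auto simp: mat_op_def if_distrib cong: if_cong)

lemma mat_op_in_Rp [simp]: "mat_op n W x \<in> Rp n"
  by (auto simp: Rp_def coord_mat_op)

lemma linear_mat_op: "linear (mat_op n W)"
  by (intro linearI fvec_eqI) (auto simp: coord_mat_op sum.distrib sum_distrib_left algebra_simps)

lemma continuous_on_mat_op: "continuous_on S (mat_op n W)"
  unfolding mat_op_def by (intro continuous_intros continuous_on_coord)

lemma inner_mat_op:
  assumes "y \<in> Rp n"
  shows "inner (mat_op n W x) y = (\<Sum>i<n. \<Sum>j<n. W $$ (i, j) * coord x j * coord y i)"
  by (simp add: inner_Rp[of _ n] coord_mat_op sum_distrib_right)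

locale symmetric_matrix =
  fixes n :: nat and W :: "real mat"
  assumes W_carrier: "W \<in> carrier_mat n n" and W_sym: "transpose_mat W = W"
begin

lemma W_index_sym: "i < n \<Longrightarrow> j < n \<Longrightarrow> W $$ (i, j) = W $$ (j, i)"
  using W_carrier W_sym by (metis index_transpose_mat(1) carrier_matD)

lemma mat_op_self_adjoint:
  assumes "x \<in> Rp n" "y \<in> Rp n"
  shows "inner (mat_op n W x) y = inner x (mat_op n W y)"
proof -
  have "inner (mat_op n W x) y = (\<Sum>i<n. \<Sum>j<n. W $$ (j, i) * coord x j * coord y i)"
    unfolding inner_mat_op[OF assms(2)] by (intro sum.cong) (auto simp: W_index_sym)
  also have "\<dots> = inner (mat_op n W y) x"
    unfolding inner_mat_op[OF assms(1)] by (subst sum.swap) (simp add: ac_simps)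
  finally show ?thesis
    by (simp add: inner_commute)
qed

lemma mat_vec_of_mat_op:
  assumes "mat_op n W v = m *\<^sub>R v"
  shows "W *\<^sub>v vec n (coord v) = m \<cdot>\<^sub>v vec n (coord v)"
proof (rule eq_vecI)
  fix i assume "i < dim_vec (m \<cdot>\<^sub>v vec n (coord v))"
  then have i: "i < n" by simp
  have "(W *\<^sub>v vec n (coord v)) $ i = coord (mat_op n W v) i"
    using W_carrier i by (auto simp: coord_mat_op scalar_prod_def atLeast0LessThan intro!: sum.cong)
  then show "(W *\<^sub>v vec n (coord v)) $ i = (m \<cdot>\<^sub>v vec n (coord v)) $ i"
    using i by (simp add: assms)
qed (use W_carrier in auto)

lemma root_of_eigenvector:
  assumes "v \<in> Rp n" "v \<noteq> 0" "mat_op n W v = m *\<^sub>R v"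
  shows "m \<in># proots (char_poly W)"
proof -
  obtain i where "coord v i \<noteq> 0"
    using assms(2) fvec_eqI[of v 0] by auto
  moreover from this have "i < n"
    using assms(1) by (auto simp: Rp_def not_le[symmetric])
  ultimately have "vec n (coord v) \<noteq> 0\<^sub>v n"
    by (metis index_vec index_zero_vec(1))
  then have "eigenvalue W m"
    using mat_vec_of_mat_op[OF assms(3)] W_carrier unfolding eigenvalue_def eigenvector_def
    by (intro exI[of _ "vec n (coord v)"]) auto
  then show ?thesis
    using eigenvalue_root_char_poly[OF W_carrier] char_poly_nonzero[OF W_carrier] by simp
qed

abbreviation "eigs \<equiv> sorted_list_of_multiset (proots (char_poly W))"

lemma length_eigs: "length eigs = n"
  by (metis mset_sorted_list_of_multiset size_mset size_proots_char_poly_symmetric[OF W_carrier W_sym])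

text \<open>\<open>eigs\<close> ascends while \<open>eigval\<close> counts from the largest value
  and from 1: index \<open>n\<close> is the head of \<open>eigs\<close>, index 1 its last
  entry.\<close>

lemma eigval_nth: "1 \<le> i \<Longrightarrow> i \<le> n \<Longrightarrow> eigval W i = eigs ! (n - i)"
  by (simp add: eigval_def rev_nth length_eigs)

lemma eigval_last_le:
  assumes "m \<in># proots (char_poly W)"
  shows "eigval W n \<le> m"
proof -
  obtain i where i: "i < n" "m = eigs ! i"
    using assms length_eigs by (metis in_set_conv_nth set_sorted_list_of_multiset)
  then have "eigs ! 0 \<le> eigs ! i"
    by (intro sorted_nth_mono) (auto simp: length_eigs)
  with i show ?thesis
    by (simp add: eigval_nth)
qed

text \<open>If \<open>m\<close> exceeded the second largest value, only the last entry of
  \<open>eigs\<close> could be at least \<open>m\<close>, but \<open>l\<close> and \<open>m\<close>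
  are two such entries. Multiset inclusion covers \<open>l = m\<close> with multiplicity
  two.\<close>

lemma eigval_second_ge:
  assumes "m \<le> l" "{#l, m#} \<subseteq># proots (char_poly W)"
  shows "m \<le> eigval W 2"
proof (rule ccontr)
  assume less: "\<not> m \<le> eigval W 2"
  have "2 \<le> n"
    using size_mset_mono[OF assms(2)] size_proots_char_poly_symmetric[OF W_carrier W_sym] by simp
  define A where "A = filter_mset (\<lambda>x. m \<le> x) (proots (char_poly W))"
  have "{#l, m#} \<subseteq># A"
    unfolding A_def using multiset_filter_mono[OF assms(2), of "\<lambda>x. m \<le> x"] assms(1) by simp
  then have "2 \<le> size A"
    using size_mset_mono by fastforce
  also have "size A = length (filter (\<lambda>x. m \<le> x) eigs)"
    unfolding A_def by (metis mset_filter mset_sorted_list_of_multiset size_mset)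
  also have "eigs = take (n - 1) eigs @ [eigs ! (n - 1)]"
    using length_eigs \<open>2 \<le> n\<close> by (metis One_nat_def Suc_pred diff_less less_eq_Suc_le
        lessI order_less_le_trans pos2 take_Suc_conv_app_nth take_all_iff order_refl)
  also have "filter (\<lambda>x. m \<le> x) (take (n - 1) eigs @ [eigs ! (n - 1)]) = filter (\<lambda>x. m \<le> x) [eigs ! (n - 1)]"
  proof -
    have "x < m" if x: "x \<in> set (take (n - 1) eigs)" for x
    proof -
      obtain i where i: "i < n - 1" "x = eigs ! i"
        using x length_eigs by (auto simp: in_set_conv_nth)
      then have "eigs ! i \<le> eigs ! (n - 2)"
        by (intro sorted_nth_mono) (auto simp: length_eigs)
      then show ?thesis
        using less i \<open>2 \<le> n\<close> by (simp add: eigval_nth)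
    qed
    then have "filter (\<lambda>x. m \<le> x) (take (n - 1) eigs) = []"
      by (force simp: filter_empty_conv)
    then show ?thesis
      by (simp only: filter_append append.simps)
  qed
  finally show False
    by (simp split: if_splits)
qed

text \<open>The Rayleigh maximum of \<open>- W\<close> is the negative of an eigenvalue of
  \<open>W\<close>, and \<open>eigval W n\<close> is the least of these.\<close>

lemma inner_mat_op_ge:
  assumes "x \<in> Rp n"
  shows "eigval W n * (norm x)\<^sup>2 \<le> inner (mat_op n W x) x"
proof (cases "x = 0")
  case False
  let ?T = "\<lambda>x. - mat_op n W x"
  obtain v m where v: "v \<in> Rp n" "v \<noteq> 0" "?T v = m *\<^sub>R v"
    and max: "\<And>x. x \<in> Rp n \<Longrightarrow> inner (?T x) x \<le> m * (norm x)\<^sup>2"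
  proof (rule self_adjoint_maximal_eigenvector[of "Rp n" x ?T])
    show "compact (Rp n \<inter> sphere 0 1)"
      using compact_sphere_Rp[of UNIV n] by simp
    show "linear ?T"
      by (intro linear_compose_neg linear_mat_op)
    show "continuous_on (Rp n) ?T"
      by (intro continuous_intros continuous_on_mat_op)
  qed (use assms False subspace_Rp mat_op_self_adjoint in auto)
  have "mat_op n W v = (- m) *\<^sub>R v"
    using v(3) by (metis minus_equation_iff scaleR_minus_left)
  then have "eigval W n \<le> - m"
    by (intro eigval_last_le root_of_eigenvector[OF v(1,2)])
  then have "eigval W n * (norm x)\<^sup>2 \<le> (- m) * (norm x)\<^sup>2"
    by (intro mult_right_mono) auto
  also have "\<dots> \<le> inner (mat_op n W x) x"
    using max[OF assms] by simp
  finally show ?thesis .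
qed (simp add: linear_0[OF linear_mat_op])

end

section \<open>Spectral gap of the mixing matrix\<close>

locale mixing_matrix = symmetric_matrix +
  assumes n_pos: "0 < n"
    and row_sum: "i < n \<Longrightarrow> (\<Sum>j<n. W $$ (i, j)) = 1"
    and eigval_first: "eigval W 1 = 1"
begin

definition ones :: fvec where
  "ones = (\<Sum>i<n. unit_fvec i)"

lemma coord_ones: "coord ones i = (if i < n then 1 else 0)"
  by (simp add: ones_def)

lemma ones_in_Rp: "ones \<in> Rp n"
  by (simp add: Rp_def coord_ones)

lemma mat_op_ones: "mat_op n W ones = ones"
  by (rule fvec_eqI) (simp add: coord_mat_op coord_ones row_sum)

lemma inner_ones: "inner ones x = (\<Sum>i<n. coord x i)"
  by (simp add: inner_Rp[OF ones_in_Rp] coord_ones)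

lemma root_le_one:
  assumes "m \<in># proots (char_poly W)"
  shows "m \<le> 1"
proof -
  obtain i where i: "i < n" "m = eigs ! i"
    using assms length_eigs by (metis in_set_conv_nth set_sorted_list_of_multiset)
  then have "eigs ! i \<le> eigs ! (n - 1)"
    by (intro sorted_nth_mono) (auto simp: length_eigs)
  with i show ?thesis
    using eigval_first n_pos by (simp add: eigval_nth)
qed

text \<open>Both 1 and \<open>m\<close> are roots, counted with multiplicity, so \<open>m\<close>
  lies between \<open>eigval W n\<close> and \<open>eigval W 2\<close>. The critical case is
  \<open>m = 1\<close>, where the root must be double.\<close>

lemma abs_le_beta:
  assumes v: "v \<in> Rp n" "v \<noteq> 0" "mat_op n W v = m *\<^sub>R v" and orth: "inner ones v = 0"
  shows "\<bar>m\<bar> \<le> beta n W"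
proof -
  have m: "m \<in># proots (char_poly W)"
    by (rule root_of_eigenvector[OF v])
  have "ones \<noteq> 0"
    using n_pos coord_ones[of 0] by auto
  then have one: "1 \<in># proots (char_poly W)"
    by (intro root_of_eigenvector[OF ones_in_Rp]) (simp_all add: mat_op_ones)
  have "{#1, m#} \<subseteq># proots (char_poly W)"
  proof (cases "m = 1")
    case True
    \<comment> \<open>A vector with equal entries orthogonal to \<open>ones\<close> would vanish. An
      entry differing from entry 0 yields the nonzero minor of \<open>ones\<close> and
      \<open>v\<close> in rows 0 and \<open>i\<close>.\<close>
    have "\<exists>i<n. coord v i \<noteq> coord v 0"
    proof (rule ccontr)
      assume "\<not> (\<exists>i<n. coord v i \<noteq> coord v 0)"
      then have const: "coord v i = coord v 0" if "i < n" for i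
        using that by blast
      have "(\<Sum>i<n. coord v i) = (\<Sum>i<n. coord v 0)"
        by (intro sum.cong refl const) simp
      then have "coord v 0 = 0"
        using orth n_pos by (simp add: inner_ones)
      have "coord v i = 0" for i
      proof (cases "i < n")
        case True
        with const[OF True] show ?thesis
          by (simp only: \<open>coord v 0 = 0\<close>)
      qed (use v(1) in \<open>simp add: Rp_def\<close>)
      with v(2) show False
        using fvec_eqI[of v 0] by simp
    qed
    then obtain i where i: "i < n" "coord v i \<noteq> coord v 0"
      by blast
    have "W *\<^sub>v vec n (coord ones) = 1 \<cdot>\<^sub>v vec n (coord ones)"
      by (rule mat_vec_of_mat_op) (simp add: mat_op_ones)
    moreover have "W *\<^sub>v vec n (coord v) = 1 \<cdot>\<^sub>v vec n (coord v)"
      by (rule mat_vec_of_mat_op) (simp add: v True)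
    ultimately have "[:- 1, 1:]\<^sup>2 dvd char_poly W"
      using i n_pos by (intro char_poly_double_root[OF W_carrier, of "vec n (coord ones)" "vec n (coord v)" _ 0 i])
        (auto simp: coord_ones)
    then have "2 \<le> count (proots (char_poly W)) 1"
      using char_poly_nonzero[OF W_carrier] by (simp add: order_divides)
    then show ?thesis
      using True by (intro mset_subset_eqI) auto
  next
    case False
    have "1 \<le> count (proots (char_poly W)) 1" "1 \<le> count (proots (char_poly W)) m"
      using m one by (metis count_greater_eq_one_iff)+
    with False show ?thesis
      by (intro mset_subset_eqI) auto
  qed
  then have "m \<le> eigval W 2"
    by (rule eigval_second_ge[OF root_le_one[OF m]])
  with eigval_last_le[OF m] show ?thesis
    by (auto simp: beta_def)
qed

text \<open>If \<^term>\<open>v\<close> maximizes \<^term>\<open>norm (mat_op n W v)\<close> on the unit sphere orthogonal to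
  \<^term>\<open>ones\<close>, then \<open>W\<^sup>2 v = s\<^sup>2 v\<close>; as \<open>(W - s) (W + s) v = 0\<close>, one of \<open>s\<close> and \<open>-s\<close> is an
  eigenvalue of \<open>W\<close> itself.\<close>

lemma mat_op_contraction:
  assumes x: "x \<in> Rp n" "inner ones x = 0"
  shows "norm (mat_op n W x) \<le> beta n W * norm x"
proof (cases "x = 0")
  case False
  let ?T = "mat_op n W"
  let ?S = "Rp n \<inter> {x. inner ones x = 0}"
  \<comment> \<open>\<open>W\<close> fixes \<open>ones\<close> and is self-adjoint, so it preserves
    the orthogonal complement.\<close>
  have T_S: "?T x \<in> ?S" if "x \<in> ?S" for x
    using that mat_op_self_adjoint[OF ones_in_Rp, of x] by (simp add: mat_op_ones)
  have sub: "subspace ?S"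
    by (intro subspace_inter subspace_Rp subspace_hyperplane)
  obtain v m where v: "v \<in> ?S" "v \<noteq> 0" "(?T \<circ> ?T) v = m *\<^sub>R v"
    and max: "\<And>x. x \<in> ?S \<Longrightarrow> inner ((?T \<circ> ?T) x) x \<le> m * (norm x)\<^sup>2"
  proof (rule self_adjoint_maximal_eigenvector[of ?S x "?T \<circ> ?T"])
    show "compact (?S \<inter> sphere 0 1)"
      by (intro compact_sphere_Rp closed_hyperplane)
    show "linear (?T \<circ> ?T)"
      by (intro linear_compose linear_mat_op)
    show "(?T \<circ> ?T) ` ?S \<subseteq> ?S"
      using T_S by auto
    show "continuous_on ?S (?T \<circ> ?T)"
      by (intro continuous_on_compose continuous_on_mat_op)
  qed (use x False sub mat_op_self_adjoint in auto)
  have TT: "inner ((?T \<circ> ?T) x) x = (norm (?T x))\<^sup>2" if "x \<in> ?S" for x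
    using that mat_op_self_adjoint[of "?T x" x] by (simp add: power2_norm_eq_inner)
  have "m * (norm v)\<^sup>2 \<ge> 0"
    using max[OF v(1)] TT[OF v(1)] by (metis zero_le_power2 order_trans)
  then have "0 \<le> m"
    using v(2) by (simp add: zero_le_mult_iff)
  define s where "s = sqrt m"
  have m: "m = s\<^sup>2" "0 \<le> s"
    using \<open>0 \<le> m\<close> by (simp_all add: s_def)
  let ?w = "?T v + s *\<^sub>R v"
  have "\<bar>s\<bar> \<le> beta n W"
  proof (cases "?w = 0")
    case True
    then have "?T v = (- s) *\<^sub>R v"
      by (simp add: eq_neg_iff_add_eq_0)
    then show ?thesis
      using abs_le_beta[of v "- s"] v by simp
  next
    case False
    have "?w \<in> ?S"
      using v(1) T_S[OF v(1)] sub by (intro subspace_add subspace_scale)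
    moreover have "?T ?w = s *\<^sub>R ?w"
      using v(3) by (simp add: linear_add[OF linear_mat_op] linear_scale[OF linear_mat_op] m
          power2_eq_square algebra_simps)
    ultimately show ?thesis
      using abs_le_beta[of ?w s] False by simp
  qed
  then have "s * norm x \<le> beta n W * norm x"
    by (intro mult_right_mono) auto
  moreover have "norm (?T x) \<le> s * norm x"
  proof (rule power2_le_imp_le)
    have "x \<in> ?S"
      using x by simp
    with max TT show "(norm (?T x))\<^sup>2 \<le> (s * norm x)\<^sup>2"
      unfolding power_mult_distrib m(1)[symmetric] by metis
  qed (simp add: m(2))
  ultimately show ?thesis
    by linarith
qed (simp add: linear_0[OF linear_mat_op])

end

section \<open>Stacked vectors\<close>

text \<open>The action of \<open>W\<close> tensored with the identity on the stacked vector
  \<open>X\<close>.\<close>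

definition mix :: "nat \<Rightarrow> real mat \<Rightarrow> (nat \<Rightarrow> fvec) \<Rightarrow> nat \<Rightarrow> fvec" where
  "mix n W X i = (\<Sum>j<n. W $$ (i, j) *\<^sub>R X j)"

lemma mix_in_Rp: "(\<And>i. i < n \<Longrightarrow> X i \<in> Rp p) \<Longrightarrow> mix n W X i \<in> Rp p"
  unfolding mix_def by (intro sum_in_Rp Rp_closed_ops) simp

text \<open>A column of the array whose rows are the agents' vectors: \<open>mix\<close> acts on
  each column as \<open>mat_op\<close>, so spectral bounds transfer to stacks by summing over the
  \<open>p\<close> columns.\<close>

definition slice :: "nat \<Rightarrow> (nat \<Rightarrow> fvec) \<Rightarrow> nat \<Rightarrow> fvec" where
  "slice n X c = (\<Sum>i<n. coord (X i) c *\<^sub>R unit_fvec i)"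

lemma coord_slice: "coord (slice n X c) i = (if i < n then coord (X i) c else 0)"
  by (auto simp: slice_def if_distrib cong: if_cong)

lemma slice_in_Rp [simp]: "slice n X c \<in> Rp n"
  by (auto simp: Rp_def coord_slice)

lemma mat_op_slice: "mat_op n W (slice n X c) = slice n (mix n W X) c"
  by (rule fvec_eqI) (simp add: coord_mat_op coord_slice mix_def)

lemma sum_inner_slices:
  assumes "\<And>i. i < n \<Longrightarrow> X i \<in> Rp p"
  shows "(\<Sum>i<n. inner (X i) (Y i)) = (\<Sum>c<p. inner (slice n X c) (slice n Y c))"
proof -
  have "(\<Sum>i<n. inner (X i) (Y i)) = (\<Sum>i<n. \<Sum>c<p. coord (X i) c * coord (Y i) c)"
    using assms by (intro sum.cong) (auto simp: inner_Rp)
  also have "\<dots> = (\<Sum>c<p. \<Sum>i<n. coord (X i) c * coord (Y i) c)"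
    by (rule sum.swap)
  also have "\<dots> = (\<Sum>c<p. inner (slice n X c) (slice n Y c))"
    by (intro sum.cong) (auto simp: inner_Rp[OF slice_in_Rp] coord_slice)
  finally show ?thesis .
qed

lemma sum_norm_sq_slices:
  assumes "\<And>i. i < n \<Longrightarrow> X i \<in> Rp p"
  shows "(\<Sum>i<n. (norm (X i))\<^sup>2) = (\<Sum>c<p. (norm (slice n X c))\<^sup>2)"
  unfolding power2_norm_eq_inner by (rule sum_inner_slices[OF assms])

context symmetric_matrix
begin

lemma mix_quadratic_ge:
  assumes "\<And>i. i < n \<Longrightarrow> X i \<in> Rp p"
  shows "eigval W n * (\<Sum>i<n. (norm (X i))\<^sup>2) \<le> (\<Sum>i<n. inner (mix n W X i) (X i))"
proof -
  have "(\<Sum>i<n. (norm (X i))\<^sup>2) = (\<Sum>c<p. (norm (slice n X c))\<^sup>2)"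
    by (intro sum_norm_sq_slices assms)
  moreover have "(\<Sum>i<n. inner (mix n W X i) (X i)) = (\<Sum>c<p. inner (mat_op n W (slice n X c)) (slice n X c))"
    unfolding mat_op_slice by (intro sum_inner_slices mix_in_Rp assms)
  ultimately show ?thesis
    by (auto simp: sum_distrib_left intro!: sum_mono inner_mat_op_ge)
qed

lemma mix_self_adjoint:
  "(\<Sum>i<n. inner (mix n W X i) (Y i)) = (\<Sum>i<n. inner (X i) (mix n W Y i))"
proof -
  have "(\<Sum>i<n. inner (mix n W X i) (Y i)) = (\<Sum>i<n. \<Sum>j<n. W $$ (j, i) * inner (X j) (Y i))"
    unfolding mix_def inner_sum_left by (intro sum.cong refl) (simp add: W_index_sym)
  also have "\<dots> = (\<Sum>j<n. \<Sum>i<n. W $$ (j, i) * inner (X j) (Y i))"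
    by (rule sum.swap)
  also have "\<dots> = (\<Sum>i<n. inner (X i) (mix n W Y i))"
    by (simp add: mix_def inner_sum_right)
  finally show ?thesis .
qed

end

text \<open>Centering makes each slice orthogonal to \<open>ones\<close>, where
  \<open>mat_op_contraction\<close> applies.\<close>

lemma (in mixing_matrix) mix_contraction:
  assumes X: "\<And>i. i < n \<Longrightarrow> X i \<in> Rp p" and centered: "(\<Sum>i<n. X i) = 0"
  shows "(\<Sum>i<n. (norm (mix n W X i))\<^sup>2) \<le> (beta n W)\<^sup>2 * (\<Sum>i<n. (norm (X i))\<^sup>2)"
proof -
  have "(norm (mat_op n W (slice n X c)))\<^sup>2 \<le> (beta n W)\<^sup>2 * (norm (slice n X c))\<^sup>2" for c
  proof -
    have "inner ones (slice n X c) = coord (\<Sum>i<n. X i) c"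
      by (simp add: inner_ones coord_slice)
    then have "norm (mat_op n W (slice n X c)) \<le> beta n W * norm (slice n X c)"
      using centered by (intro mat_op_contraction) auto
    then show ?thesis
      unfolding power_mult_distrib[symmetric] by (intro power_mono) auto
  qed
  moreover have "(\<Sum>i<n. (norm (X i))\<^sup>2) = (\<Sum>c<p. (norm (slice n X c))\<^sup>2)"
    by (intro sum_norm_sq_slices X)
  moreover have "(\<Sum>i<n. (norm (mix n W X i))\<^sup>2) = (\<Sum>c<p. (norm (mat_op n W (slice n X c)))\<^sup>2)"
    unfolding mat_op_slice by (intro sum_norm_sq_slices mix_in_Rp X)
  ultimately show ?thesis
    by (simp add: sum_distrib_left sum_mono)
qed

section \<open>Decentralized gradient descent\<close>

text \<open>The variance identity: centering removes exactly \<open>n\<close> times the squared norm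
  of the mean.\<close>

lemma sum_norm_sq_centered_le:
  fixes X :: "nat \<Rightarrow> 'a::real_inner"
  assumes "0 < n"
  shows "(\<Sum>i<n. (norm (X i - (1 / real n) *\<^sub>R (\<Sum>i<n. X i)))\<^sup>2) \<le> (\<Sum>i<n. (norm (X i))\<^sup>2)"
proof -
  define c where "c = (1 / real n) *\<^sub>R (\<Sum>i<n. X i)"
  have "(norm (X i - c))\<^sup>2 = (norm (X i))\<^sup>2 - 2 * inner (X i) c + (norm c)\<^sup>2" for i
    unfolding power2_norm_eq_inner
    by (simp add: inner_diff_left inner_diff_right inner_commute[of c "X i"] del: dot_square_norm)
  then have "(\<Sum>i<n. (norm (X i - c))\<^sup>2)
      = (\<Sum>i<n. (norm (X i))\<^sup>2) - 2 * inner (\<Sum>i<n. X i) c + real n * (norm c)\<^sup>2"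
    by (simp add: sum.distrib sum_subtractf inner_sum_left sum_distrib_left)
  also have "(\<Sum>i<n. X i) = real n *\<^sub>R c"
    using assms by (simp add: c_def)
  finally have "(\<Sum>i<n. (norm (X i - c))\<^sup>2) = (\<Sum>i<n. (norm (X i))\<^sup>2) - real n * (norm c)\<^sup>2"
    by (simp add: power2_norm_eq_inner[symmetric])
  then show ?thesis
    unfolding c_def by simp
qed

text \<open>Young's inequality, from the square of \<open>\<delta> *\<^sub>R u - r\<close>, splits
  the cross term. This is the origin of \<open>\<delta>\<close> in the rate.\<close>

lemma norm_sq_perturbed_le:
  fixes u r :: "'a::real_inner"
  assumes "0 < \<delta>" "0 < \<alpha>"
  shows "(norm (u + \<alpha> *\<^sub>R r))\<^sup>2 \<le> (1 + \<alpha> * \<delta>) * (norm u)\<^sup>2 + \<alpha> * (\<alpha> + inverse \<delta>) * (norm r)\<^sup>2"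
proof -
  have "0 \<le> \<alpha> / \<delta> * (norm (\<delta> *\<^sub>R u - r))\<^sup>2"
    using assms by simp
  also have "(norm (\<delta> *\<^sub>R u - r))\<^sup>2 = \<delta>\<^sup>2 * (norm u)\<^sup>2 - 2 * \<delta> * inner u r + (norm r)\<^sup>2"
    unfolding power2_norm_eq_inner
    by (simp add: inner_diff_left inner_diff_right inner_commute[of r u] power2_eq_square algebra_simps
        del: dot_square_norm)
  also have "\<alpha> / \<delta> * \<dots> = \<alpha> * \<delta> * (norm u)\<^sup>2 - 2 * \<alpha> * inner u r + \<alpha> * inverse \<delta> * (norm r)\<^sup>2"
    using assms by (simp add: field_simps power2_eq_square)
  finally have "2 * \<alpha> * inner u r \<le> \<alpha> * \<delta> * (norm u)\<^sup>2 + \<alpha> * inverse \<delta> * (norm r)\<^sup>2"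
    by simp
  moreover have "(norm (u + \<alpha> *\<^sub>R r))\<^sup>2 = (norm u)\<^sup>2 + 2 * \<alpha> * inner u r + \<alpha>\<^sup>2 * (norm r)\<^sup>2"
    unfolding power2_norm_eq_inner
    by (simp add: inner_add_left inner_add_right inner_commute[of r u] power2_eq_square algebra_simps
        del: dot_square_norm)
  ultimately show ?thesis
    by (simp add: algebra_simps power2_eq_square)
qed

context dgd
begin

sublocale mixing_matrix n W
  using n_pos W_dim W_symmetric W_stochastic eigval_first
  by unfold_locales (auto simp: doubly_stochastic_def)

lemma W_nonneg: "i < n \<Longrightarrow> j < n \<Longrightarrow> 0 \<le> W $$ (i, j)"
  and column_sum: "j < n \<Longrightarrow> (\<Sum>i<n. W $$ (i, j)) = 1"
  using W_stochastic by (auto simp: doubly_stochastic_def)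

lemma smooth: "i < n \<Longrightarrow> smooth_convex p (f i) (L i)"
  using f_convex f_differentiable L_pos grad_lipschitz by unfold_locales auto

lemma L_le_Lh: "i < n \<Longrightarrow> L i \<le> Lh n L"
  by (simp add: Lh_def)

lemma Lh_pos: "0 < Lh n L"
  using L_le_Lh[of 0] L_pos[of 0] n_pos by simp

lemma fsum_smooth: "smooth_convex p (fsum n f) (\<Sum>i<n. L i)"
  and grad_fsum: "x \<in> Rp p \<Longrightarrow> grad p (fsum n f) x = (\<Sum>i<n. grad p (f i) x)"
  using smooth_convex_sum[of "{..<n}" p f L] grad_sum[of "{..<n}" p f L] smooth n_pos
  unfolding fsum_def[abs_def] by auto

lemma sum_L: "(\<Sum>i<n. L i) = real n * Lbar n L"
  using n_pos by (simp add: Lbar_def)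

lemma Lbar_pos: "0 < Lbar n L"
  using smooth_convex.L_pos[OF fsum_smooth] sum_L n_pos by (simp add: zero_less_mult_iff)

lemma beta_nonneg: "0 \<le> beta n W"
  by (simp add: beta_def)

text \<open>Each inner product is at most half the sum of the squared norms; row sums handle one
  half, column sums the other. This makes \<open>disagreement\<close> nonnegative.\<close>

lemma mix_quadratic_le:
  "(\<Sum>i<n. inner (mix n W X i) (X i)) \<le> (\<Sum>i<n. (norm (X i))\<^sup>2)"
proof -
  have "inner (mix n W X i) (X i) \<le> (\<Sum>j<n. W $$ (i, j) * ((norm (X i))\<^sup>2 / 2 + (norm (X j))\<^sup>2 / 2))"
    if "i < n" for i
  proof -
    have "inner (X j) (X i) \<le> (norm (X i))\<^sup>2 / 2 + (norm (X j))\<^sup>2 / 2" for j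
    proof -
      have "0 \<le> inner (X j - X i) (X j - X i)"
        by (rule inner_ge_zero)
      then show ?thesis
        unfolding power2_norm_eq_inner
        by (simp add: inner_diff_left inner_diff_right inner_commute[of "X i" "X j"] del: dot_square_norm)
    qed
    then show ?thesis
      using that unfolding mix_def inner_sum_left inner_scaleR_left
      by (intro sum_mono mult_left_mono W_nonneg) auto
  qed
  then have "(\<Sum>i<n. inner (mix n W X i) (X i))
      \<le> (\<Sum>i<n. \<Sum>j<n. W $$ (i, j) * ((norm (X i))\<^sup>2 / 2 + (norm (X j))\<^sup>2 / 2))"
    by (intro sum_mono) auto
  also have "\<dots> = (\<Sum>i<n. \<Sum>j<n. W $$ (i, j) * ((norm (X i))\<^sup>2 / 2))
      + (\<Sum>i<n. \<Sum>j<n. W $$ (i, j) * ((norm (X j))\<^sup>2 / 2))"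
    by (simp only: distrib_left sum.distrib)
  also have "(\<Sum>i<n. \<Sum>j<n. W $$ (i, j) * ((norm (X j))\<^sup>2 / 2))
      = (\<Sum>j<n. \<Sum>i<n. W $$ (i, j) * ((norm (X j))\<^sup>2 / 2))"
    by (rule sum.swap)
  also have "\<dots> = (\<Sum>j<n. (norm (X j))\<^sup>2 / 2)"
    unfolding sum_distrib_right[symmetric] by (simp add: column_sum)
  also have "(\<Sum>i<n. \<Sum>j<n. W $$ (i, j) * ((norm (X i))\<^sup>2 / 2)) = (\<Sum>i<n. (norm (X i))\<^sup>2 / 2)"
    unfolding sum_distrib_right[symmetric] by (simp add: row_sum)
  finally show ?thesis
    by (simp flip: sum.distrib)
qed

lemma minimizers_Proj:
  defines "S \<equiv> minimizers p (fsum n f)"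
  shows "Proj S x \<in> S" and "y \<in> S \<Longrightarrow> norm (x - Proj S x) \<le> norm (x - y)"
proof -
  have "closed S" "S \<noteq> {}" "S \<subseteq> Rp p"
    using smooth_convex.closed_minimizers[OF fsum_smooth] minimizers_nonempty
    by (auto simp: S_def minimizers_def)
  from Proj_nearest[OF this, where x = x] show "Proj S x \<in> S" "y \<in> S \<Longrightarrow> norm (x - Proj S x) \<le> norm (x - y)"
    by (simp_all add: dist_norm)
qed

end

section \<open>Energy descent and the bound on the gradients\<close>

locale dgd_run = dgd +
  fixes \<alpha> :: real
  assumes \<alpha>_pos: "0 < \<alpha>" and \<alpha>_Lh: "\<alpha> * Lh n L \<le> 1 + eigval W n"
begin

abbreviation "iter \<equiv> dgd_iter n p f W \<alpha>"
abbreviation "avg \<equiv> xbar n p f W \<alpha>"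
abbreviation "g k i \<equiv> grad p (f i) (iter k i)"

lemma iter_Suc: "iter (Suc k) i = mix n W (iter k) i - \<alpha> *\<^sub>R g k i"
  by (simp add: mix_def)

lemma iter_in_Rp: "i < n \<Longrightarrow> iter k i \<in> Rp p"
proof (induction k arbitrary: i)
  case (Suc k)
  then show ?case
    unfolding iter_Suc
    by (intro Rp_closed_ops mix_in_Rp smooth_convex.grad_in_Rp[OF smooth])
qed simp

lemma avg_in_Rp: "avg k \<in> Rp p"
  unfolding xbar_def by (intro Rp_closed_ops sum_in_Rp iter_in_Rp) simp

text \<open>The quadratic form of the identity minus \<open>W\<close> on the stack.\<close>

definition disagreement :: "(nat \<Rightarrow> fvec) \<Rightarrow> real" where
  "disagreement X = (\<Sum>i<n. (norm (X i))\<^sup>2 - inner (mix n W X i) (X i))"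

lemma disagreement_add:
  "disagreement (\<lambda>i. X i + Y i) = disagreement X + disagreement Y + 2 * (\<Sum>i<n. inner (X i - mix n W X i) (Y i))"
proof -
  have add: "mix n W (\<lambda>i. X i + Y i) i = mix n W X i + mix n W Y i" for i
    by (simp add: mix_def scaleR_add_right sum.distrib)
  have "(\<Sum>i<n. inner (mix n W Y i) (X i)) = (\<Sum>i<n. inner (mix n W X i) (Y i))"
    using mix_self_adjoint[of Y X] by (simp add: inner_commute)
  then show ?thesis
    unfolding disagreement_def add power2_norm_eq_inner
    by (simp add: inner_add_left inner_add_right inner_diff_left inner_commute[of "Y _" "X _"]
        sum.distrib sum_subtractf sum_distrib_left del: dot_square_norm)
qed

text \<open>This is \<open>2 \<alpha>\<close> times the function that the iteration descends, whose gradient is Lipschitz with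
  constant \<open>L\<^sub>h + (1 - \<lambda>\<^sub>n) / \<alpha> \<le> 2 / \<alpha>\<close>.\<close>

definition energy :: "(nat \<Rightarrow> fvec) \<Rightarrow> real" where
  "energy X = 2 * \<alpha> * (\<Sum>i<n. f i (X i)) + disagreement X"

text \<open>With \<open>d\<close> the step, the cross terms of the objective and of the disagreement
  cancel. What remains is at most \<open>(1 - eigval W n) - (2 - \<alpha> * Lh n L)\<close> times
  the squared norm of \<open>d\<close>, and the stepsize bound is what makes this factor
  nonpositive.\<close>

lemma energy_decreasing: "energy (iter (Suc k)) \<le> energy (iter k)"
proof -
  define d where "d i = iter (Suc k) i - iter k i" for i
  have d_in: "d i \<in> Rp p" if "i < n" for i
    unfolding d_def using that by (intro Rp_closed_ops iter_in_Rp)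
  have step: "iter (Suc k) = (\<lambda>i. iter k i + d i)"
    by (simp add: d_def fun_eq_iff del: dgd_iter.simps)
  have f_step: "2 * \<alpha> * f i (iter (Suc k) i) \<le> 2 * \<alpha> * f i (iter k i)
      - 2 * inner (iter k i - mix n W (iter k) i) (d i) - (2 - \<alpha> * Lh n L) * (norm (d i))\<^sup>2" if "i < n" for i
  proof -
    have "f i (iter (Suc k) i) \<le> f i (iter k i) + inner (g k i) (d i) + L i / 2 * (norm (d i))\<^sup>2"
      unfolding d_def using that by (intro smooth_convex.descent[OF smooth] iter_in_Rp)
    also have "\<dots> \<le> f i (iter k i) + inner (g k i) (d i) + Lh n L / 2 * (norm (d i))\<^sup>2"
      using L_le_Lh[OF that] by (simp add: mult_right_mono)
    finally have "2 * \<alpha> * f i (iter (Suc k) i)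
        \<le> 2 * \<alpha> * (f i (iter k i) + inner (g k i) (d i) + Lh n L / 2 * (norm (d i))\<^sup>2)"
      using \<alpha>_pos by (intro mult_left_mono) auto
    \<comment> \<open>The iteration rule solved for the gradient: pairing with \<open>d i\<close>
      trades the gradient term for a disagreement term and
      \<open>- (norm (d i))\<^sup>2\<close>.\<close>
    moreover have "\<alpha> *\<^sub>R g k i = - (iter k i - mix n W (iter k) i) - d i"
      by (simp add: d_def iter_Suc del: dgd_iter.simps)
    then have "\<alpha> * inner (g k i) (d i) = - inner (iter k i - mix n W (iter k) i) (d i) - (norm (d i))\<^sup>2"
      by (metis inner_diff_left inner_minus_left inner_scaleR_left power2_norm_eq_inner)
    ultimately show ?thesis
      by (simp add: algebra_simps del: dgd_iter.simps)
  qed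
  have "2 * \<alpha> * (\<Sum>i<n. f i (iter (Suc k) i)) \<le> 2 * \<alpha> * (\<Sum>i<n. f i (iter k i))
      - 2 * (\<Sum>i<n. inner (iter k i - mix n W (iter k) i) (d i)) - (2 - \<alpha> * Lh n L) * (\<Sum>i<n. (norm (d i))\<^sup>2)"
    unfolding sum_distrib_left sum_subtractf[symmetric] by (intro sum_mono f_step) simp
  moreover have "disagreement d \<le> (1 - eigval W n) * (\<Sum>i<n. (norm (d i))\<^sup>2)"
    using mix_quadratic_ge[of d p, OF d_in] by (simp add: disagreement_def sum_subtractf algebra_simps)
  moreover have "(1 - eigval W n) * (\<Sum>i<n. (norm (d i))\<^sup>2) \<le> (2 - \<alpha> * Lh n L) * (\<Sum>i<n. (norm (d i))\<^sup>2)"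
    using \<alpha>_Lh by (intro mult_right_mono sum_nonneg) auto
  moreover have "disagreement (iter (Suc k)) = disagreement (iter k) + disagreement d
      + 2 * (\<Sum>i<n. inner (iter k i - mix n W (iter k) i) (d i))"
    unfolding step by (rule disagreement_add)
  ultimately show ?thesis
    unfolding energy_def by linarith
qed

lemma sum_f_iter_le: "(\<Sum>i<n. f i (iter k i)) \<le> (\<Sum>i<n. f i 0)"
proof -
  have "energy (iter k) \<le> energy (iter 0)"
    by (induction k) (use energy_decreasing order_trans in blast)+
  moreover have "disagreement (iter 0) = 0"
    by (simp add: disagreement_def)
  moreover have "0 \<le> disagreement (iter k)"
    using mix_quadratic_le by (simp add: disagreement_def sum_subtractf)
  ultimately have "2 * \<alpha> * (\<Sum>i<n. f i (iter k i)) \<le> 2 * \<alpha> * (\<Sum>i<n. f i 0)"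
    by (simp add: energy_def)
  then show ?thesis
    using \<alpha>_pos by simp
qed

abbreviation "D \<equiv> D_const n p f L"

lemma INF_le: "i < n \<Longrightarrow> x \<in> Rp p \<Longrightarrow> (INF x\<in>Rp p. f i x) \<le> f i x"
  by (intro cINF_lower f_bounded_below)

lemma D_sq: "D\<^sup>2 = 2 * Lh n L * (\<Sum>i<n. f i 0 - (INF x\<in>Rp p. f i x))"
  unfolding D_const_def using Lh_pos
  by (intro real_sqrt_pow2 mult_nonneg_nonneg sum_nonneg) (auto simp: INF_le)

lemma D_nonneg: "0 \<le> D"
  unfolding D_const_def using Lh_pos
  by (intro real_sqrt_ge_zero mult_nonneg_nonneg sum_nonneg) (auto simp: INF_le)

text \<open>Only the sum of the agents' values is controlled, so \<open>L i\<close> is first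
  replaced by the uniform \<open>Lh n L\<close>, and the comparison with the values at 0 is made
  after summing.\<close>

lemma sum_norm_g_sq_le: "(\<Sum>i<n. (norm (g k i))\<^sup>2) \<le> D\<^sup>2"
proof -
  let ?m = "\<lambda>i. INF x\<in>Rp p. f i x"
  have "(norm (g k i))\<^sup>2 \<le> 2 * Lh n L * (f i (iter k i) - ?m i)" if "i < n" for i
  proof -
    have "(norm (g k i))\<^sup>2 \<le> 2 * L i * (f i (iter k i) - ?m i)"
      using that by (intro smooth_convex.norm_grad_sq_le[OF smooth] iter_in_Rp INF_le)
    also have "\<dots> \<le> 2 * Lh n L * (f i (iter k i) - ?m i)"
      using that L_le_Lh[OF that] INF_le[OF that iter_in_Rp[OF that]] by (intro mult_right_mono) auto
    finally show ?thesis .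
  qed
  then have "(\<Sum>i<n. (norm (g k i))\<^sup>2) \<le> (\<Sum>i<n. 2 * Lh n L * (f i (iter k i) - ?m i))"
    by (intro sum_mono) simp
  also have "\<dots> = 2 * Lh n L * ((\<Sum>i<n. f i (iter k i)) - (\<Sum>i<n. ?m i))"
    by (simp only: sum_distrib_left[symmetric] sum_subtractf)
  also have "\<dots> \<le> 2 * Lh n L * ((\<Sum>i<n. f i 0) - (\<Sum>i<n. ?m i))"
    using Lh_pos sum_f_iter_le by (intro mult_left_mono) auto
  finally show ?thesis
    by (simp only: D_sq sum_subtractf)
qed

section \<open>Dynamics of the average and consensus\<close>

abbreviation "gavg k \<equiv> (1 / real n) *\<^sub>R (\<Sum>i<n. g k i)"

text \<open>Unit column sums make mixing preserve the average.\<close>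

lemma avg_Suc: "avg (Suc k) = avg k - \<alpha> *\<^sub>R gavg k"
proof -
  have "(\<Sum>i<n. mix n W (iter k) i) = (\<Sum>j<n. \<Sum>i<n. W $$ (i, j) *\<^sub>R iter k j)"
    unfolding mix_def by (rule sum.swap)
  also have "\<dots> = (\<Sum>j<n. iter k j)"
    unfolding scaleR_sum_left[symmetric] by (simp add: column_sum)
  finally show ?thesis
    unfolding xbar_def iter_Suc sum_subtractf
    by (simp add: scaleR_diff_right scaleR_sum_right[symmetric] mult.commute)
qed

text \<open>The deviation starts at 0, contracts by \<open>beta n W\<close> and receives at most
  \<open>\<alpha> * D\<close> per step; the bound is the fixed point of this recursion.\<close>

lemma consensus_L2:
  "L2_set (\<lambda>i. norm (iter k i - avg k)) {..<n} \<le> \<alpha> * D / (1 - beta n W)"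
proof (induction k)
  case 0
  have "L2_set (\<lambda>i. norm (iter 0 i - avg 0)) {..<n} = 0"
    by (simp add: L2_set_def xbar_def)
  then show ?case
    using \<alpha>_pos D_nonneg beta_less_1 by simp
next
  case (Suc k)
  let ?y = "\<lambda>i. iter k i - avg k"
  let ?r = "\<lambda>i. g k i - gavg k"
  have y_step: "iter (Suc k) i - avg (Suc k) = mix n W ?y i - \<alpha> *\<^sub>R ?r i" if "i < n" for i
  proof -
    \<comment> \<open>Unit row sums: mixing leaves the common vector \<open>avg k\<close>
      unchanged.\<close>
    have "mix n W ?y i = mix n W (iter k) i - avg k"
      using row_sum[OF that] by (simp add: mix_def scaleR_diff_right sum_subtractf flip: scaleR_sum_left)
    then show ?thesis
      unfolding iter_Suc avg_Suc by (simp add: algebra_simps)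
  qed
  have "L2_set (\<lambda>i. norm (iter (Suc k) i - avg (Suc k))) {..<n}
      \<le> L2_set (\<lambda>i. norm (mix n W ?y i) + \<alpha> * norm (?r i)) {..<n}"
  proof (rule L2_set_mono)
    fix i assume "i \<in> {..<n}"
    then show "norm (iter (Suc k) i - avg (Suc k)) \<le> norm (mix n W ?y i) + \<alpha> * norm (?r i)"
      using norm_triangle_ineq4[of "mix n W ?y i" "\<alpha> *\<^sub>R ?r i"] \<alpha>_pos y_step[of i] by simp
  qed simp
  also have "\<dots> \<le> L2_set (\<lambda>i. norm (mix n W ?y i)) {..<n} + \<alpha> * L2_set (\<lambda>i. norm (?r i)) {..<n}"
    using L2_set_triangle_ineq \<alpha>_pos by (simp add: L2_set_right_distrib)
  also have "L2_set (\<lambda>i. norm (mix n W ?y i)) {..<n} \<le> beta n W * L2_set (\<lambda>i. norm (?y i)) {..<n}"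
  proof -
    have "(\<Sum>i<n. ?y i) = 0"
      using n_pos by (simp add: sum_subtractf xbar_def flip: scaleR_left.sum)
    then have "(\<Sum>i<n. (norm (mix n W ?y i))\<^sup>2) \<le> (beta n W)\<^sup>2 * (\<Sum>i<n. (norm (?y i))\<^sup>2)"
      by (intro mix_contraction[of _ p] Rp_closed_ops iter_in_Rp avg_in_Rp)
    then show ?thesis
      unfolding L2_set_def using beta_nonneg
      by (metis real_sqrt_le_mono real_sqrt_mult real_sqrt_abs abs_of_nonneg)
  qed
  also have "\<dots> \<le> beta n W * (\<alpha> * D / (1 - beta n W))"
    by (intro mult_left_mono Suc.IH beta_nonneg)
  also have "L2_set (\<lambda>i. norm (?r i)) {..<n} \<le> D"
    unfolding L2_set_def
    using sum_norm_sq_centered_le[OF n_pos, of "g k"] sum_norm_g_sq_le[of k] D_nonneg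
    by (intro real_le_lsqrt) auto
  finally have "L2_set (\<lambda>i. norm (iter (Suc k) i - avg (Suc k))) {..<n}
      \<le> beta n W * (\<alpha> * D / (1 - beta n W)) + \<alpha> * D"
    using \<alpha>_pos by simp
  also have "\<dots> = \<alpha> * D / (1 - beta n W)"
    using beta_less_1 by (simp add: field_simps)
  finally show ?case .
qed

lemma consensus: "i < n \<Longrightarrow> norm (iter k i - avg k) \<le> \<alpha> * D / (1 - beta n W)"
  using member_le_L2_set[of "{..<n}" i "\<lambda>i. norm (iter k i - avg k)"] consensus_L2[of k] by simp

text \<open>Lipschitz continuity turns each agent's deviation into a gradient error, and the factor
  \<open>1 / real n\<close> absorbs the sum over agents.\<close>

lemma gavg_error:
  "norm ((1 / real n) *\<^sub>R grad p (fsum n f) (avg k) - gavg k) \<le> \<alpha> * Lh n L * D / (1 - beta n W)"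
proof -
  have "norm (\<Sum>i<n. grad p (f i) (avg k) - g k i) \<le> (\<Sum>i<n. Lh n L * (\<alpha> * D / (1 - beta n W)))"
  proof (rule sum_norm_le)
    fix i assume "i \<in> {..<n}"
    then have i: "i < n" by simp
    have "norm (grad p (f i) (avg k) - g k i) \<le> L i * norm (avg k - iter k i)"
      by (rule lipschitz_on_normD[OF grad_lipschitz[OF i] avg_in_Rp iter_in_Rp[OF i]])
    also have "\<dots> \<le> Lh n L * (\<alpha> * D / (1 - beta n W))"
      using consensus[OF i, of k] L_le_Lh[OF i] Lh_pos by (intro mult_mono) (auto simp: norm_minus_commute)
    finally show "norm (grad p (f i) (avg k) - g k i) \<le> Lh n L * (\<alpha> * D / (1 - beta n W))" .
  qed
  then have "norm (\<Sum>i<n. grad p (f i) (avg k) - g k i) / real n \<le> Lh n L * (\<alpha> * D / (1 - beta n W))"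
    using n_pos by (simp add: divide_le_eq mult.commute)
  moreover have "(1 / real n) *\<^sub>R grad p (fsum n f) (avg k) - gavg k
      = (1 / real n) *\<^sub>R (\<Sum>i<n. grad p (f i) (avg k) - g k i)"
    by (simp add: grad_fsum[OF avg_in_Rp] sum_subtractf scaleR_diff_right)
  ultimately show ?thesis
    using n_pos by (simp add: ac_simps)
qed

end

section \<open>Exact gradient steps for the summed objective\<close>

context dgd
begin

abbreviation "F \<equiv> fsum n f"
abbreviation "S \<equiv> minimizers p F"

lemma Proj_in_Rp: "Proj S x \<in> Rp p"
  using minimizers_Proj(1)[of x] by (simp add: minimizers_def)

lemma grad_Proj [simp]: "grad p F (Proj S x) = 0"
  by (rule smooth_convex.grad_minimizer[OF fsum_smooth minimizers_Proj(1)])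

definition coercive :: "real \<Rightarrow> bool" where
  "coercive \<nu> \<longleftrightarrow> (\<forall>x\<in>Rp p. \<nu> * (norm (x - Proj S x))\<^sup>2 \<le> inner (grad p F x) (x - Proj S x))"

lemma strongly_convex_coercive: "strongly_convex p F \<nu> \<Longrightarrow> coercive \<nu>"
  using Proj_in_Rp unfolding strongly_convex_def coercive_def by (metis diff_zero grad_Proj)

lemma restricted_strongly_convex_coercive: "restricted_strongly_convex p F \<nu> \<Longrightarrow> coercive \<nu>"
  unfolding restricted_strongly_convex_def coercive_def by (simp add: Let_def)

text \<open>At a point outside \<open>S\<close>, coercivity bounds the gradient from below and the
  Lipschitz constant bounds it from above, both in multiples of the positive distance to
  \<open>S\<close>. If \<open>S = Rp p\<close>, every modulus is coercive.\<close>

lemma coercive_le_Lbar: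
  assumes "coercive \<nu>" "S \<noteq> Rp p"
  shows "\<nu> / real n \<le> Lbar n L"
proof -
  have "S \<subseteq> Rp p"
    by (auto simp: minimizers_def)
  with assms(2) obtain x where x: "x \<in> Rp p" "x \<notin> S"
    by blast
  define e where "e = x - Proj S x"
  have "e \<noteq> 0"
    using x(2) minimizers_Proj(1)[of x] by (auto simp: e_def)
  have "\<nu> * (norm e)\<^sup>2 \<le> inner (grad p F x - grad p F (Proj S x)) e"
    using assms(1) x(1) by (simp add: coercive_def e_def)
  also have "\<dots> \<le> norm (grad p F x - grad p F (Proj S x)) * norm e"
    by (rule norm_cauchy_schwarz)
  also have "norm (grad p F x - grad p F (Proj S x)) \<le> (\<Sum>i<n. L i) * norm e"
    unfolding e_def
    by (rule lipschitz_on_normD[OF smooth_convex.lipschitz[OF fsum_smooth] x(1) Proj_in_Rp])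
  finally have "\<nu> * (norm e)\<^sup>2 \<le> (real n * Lbar n L) * (norm e)\<^sup>2"
    by (simp add: sum_L power2_eq_square mult_right_mono mult.assoc)
  then have "\<nu> \<le> real n * Lbar n L"
    using \<open>e \<noteq> 0\<close> by simp
  then show ?thesis
    using n_pos by (simp add: divide_le_eq mult.commute)
qed

lemma constants_cases:
  assumes constants: "strong_constants n p f L c1 c2 \<or> restricted_constants n p f L c1 c2"
    and \<alpha>: "0 < \<alpha>" "\<alpha> \<le> c1"
  obtains \<nu> where "coercive \<nu>" "\<alpha> * Lbar n L \<le> 1" "c2 \<le> \<nu> / real n" "S \<noteq> Rp p \<Longrightarrow> \<alpha> * c2 < 1"
  using constants
proof
  assume "strong_constants n p f L c1 c2"
  then obtain \<mu> where \<mu>: "0 < \<mu>" "strongly_convex p F \<mu>"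
    and c: "c1 = 1 / (\<mu> / real n + Lbar n L)" "c2 = (\<mu> / real n) * Lbar n L / (\<mu> / real n + Lbar n L)"
    by (auto simp: strong_constants_def)
  define m where "m = \<mu> / real n"
  have "0 < m"
    using \<mu> n_pos by (simp add: m_def)
  have "\<alpha> * (m + Lbar n L) \<le> 1"
    using \<alpha>(2) c(1) \<open>0 < m\<close> Lbar_pos by (simp add: m_def[symmetric] pos_le_divide_eq)
  \<comment> \<open>Two positive terms with sum at most 1 are each below 1; \<open>c2\<close> is at
    most \<open>m\<close>, being \<open>m\<close> times a fraction.\<close>
  then have sum_le: "\<alpha> * m + \<alpha> * Lbar n L \<le> 1"
    by (simp add: algebra_simps)
  have c2_le: "c2 \<le> m"
    unfolding c(2) m_def[symmetric] using \<open>0 < m\<close> Lbar_pos by (simp add: divide_simps)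
  have "0 < \<alpha> * Lbar n L" "0 < \<alpha> * m"
    using \<alpha>(1) Lbar_pos \<open>0 < m\<close> by simp_all
  moreover have "\<alpha> * c2 \<le> \<alpha> * m"
    using c2_le \<alpha>(1) by simp
  ultimately have "\<alpha> * Lbar n L \<le> 1" "\<alpha> * c2 < 1"
    using sum_le by linarith+
  with c2_le show thesis
    by (intro that[OF strongly_convex_coercive[OF \<mu>(2)]]) (simp_all add: m_def)
next
  assume "restricted_constants n p f L c1 c2"
  then obtain \<nu> \<theta> where \<nu>: "0 < \<nu>" "restricted_strongly_convex p F \<nu>" and \<theta>: "0 \<le> \<theta>" "\<theta> \<le> 1"
    and c: "c1 = \<theta> / Lbar n L" "c2 = (1 - \<theta>) * (\<nu> / real n)"
    by (auto simp: restricted_constants_def)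
  have \<alpha>_le: "\<alpha> * Lbar n L \<le> \<theta>"
    using \<alpha>(2) c(1) Lbar_pos by (simp add: pos_le_divide_eq)
  note coercive = restricted_strongly_convex_coercive[OF \<nu>(2)]
  have "\<alpha> * c2 < 1" if "S \<noteq> Rp p"
  \<comment> \<open>\<open>c1\<close> bounds \<open>\<alpha> * Lbar n L\<close> by
    \<open>\<theta>\<close>, and \<open>\<nu> / real n\<close> is at most \<open>Lbar n L\<close>,
    so the product is at most \<open>(1 - \<theta>) * \<theta>\<close>, hence at most 1/4.\<close>
  proof -
    have "\<alpha> * c2 = (1 - \<theta>) * (\<alpha> * (\<nu> / real n))"
      by (simp add: c(2))
    also have "\<dots> \<le> (1 - \<theta>) * (\<alpha> * Lbar n L)"
      using coercive_le_Lbar[OF coercive that] \<alpha>(1) \<theta> by (intro mult_left_mono) auto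
    also have "\<dots> \<le> (1 - \<theta>) * \<theta>"
      using \<alpha>_le \<theta> by (intro mult_left_mono) auto
    also have "\<dots> = 1 / 4 - (\<theta> - 1 / 2)\<^sup>2"
      by (simp add: power2_eq_square algebra_simps)
    also have "\<dots> < 1"
      using zero_le_power2[of "\<theta> - 1 / 2"] by linarith
    finally show ?thesis .
  qed
  moreover have "c2 \<le> \<nu> / real n"
    unfolding c(2) using \<theta> \<nu>(1) by (intro mult_left_le_one_le) auto
  ultimately show thesis
    using \<alpha>_le \<theta> by (intro that[OF coercive]) auto
qed

text \<open>Since \<open>\<alpha> Lbar \<le> 1\<close>, cocoercivity absorbs the quadratic term of the expanded square into half of
  the linear term, and the other half contracts.\<close>

lemma gradient_step_contraction:
  assumes "coercive \<nu>" "0 < \<alpha>" "\<alpha> * Lbar n L \<le> 1" "c2 \<le> \<nu> / real n" "x \<in> Rp p"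
  shows "(norm (x - Proj S x - (\<alpha> / real n) *\<^sub>R grad p F x))\<^sup>2 \<le> (1 - \<alpha> * c2) * (norm (x - Proj S x))\<^sup>2"
proof -
  define e where "e = x - Proj S x"
  define G where "G = (1 / real n) *\<^sub>R grad p F x"
  have grad: "grad p F x = real n *\<^sub>R G"
    using n_pos by (simp add: G_def)
  have "(norm (grad p F x))\<^sup>2 / (real n * Lbar n L) \<le> inner (grad p F x) e"
    using smooth_convex.cocoercive[OF fsum_smooth assms(5) Proj_in_Rp, of x] by (simp add: e_def sum_L)
  then have cocoercive: "(norm G)\<^sup>2 \<le> Lbar n L * inner G e"
    using n_pos Lbar_pos by (simp add: grad power_mult_distrib power2_eq_square divide_simps mult_ac)
  have "\<nu> * (norm e)\<^sup>2 \<le> inner (grad p F x) e"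
    using assms(1,5) by (simp add: coercive_def e_def)
  then have linear: "\<nu> / real n * (norm e)\<^sup>2 \<le> inner G e"
    using n_pos by (simp add: grad divide_simps mult_ac)
  have "0 \<le> Lbar n L * inner G e"
    using cocoercive zero_le_power2[of "norm G"] by linarith
  then have "0 \<le> inner G e"
    using Lbar_pos by (simp add: zero_le_mult_iff)
  have "\<alpha> * (norm G)\<^sup>2 \<le> \<alpha> * (Lbar n L * inner G e)"
    using cocoercive assms(2) by (intro mult_left_mono) auto
  also have "\<dots> \<le> 1 * inner G e"
    unfolding mult.assoc[symmetric] by (intro mult_right_mono assms(3) \<open>0 \<le> inner G e\<close>)
  finally have G: "\<alpha> * (norm G)\<^sup>2 \<le> inner G e"
    by simp
  have "c2 * (norm e)\<^sup>2 \<le> \<nu> / real n * (norm e)\<^sup>2"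
    using assms(4) by (intro mult_right_mono) auto
  with linear have c2: "c2 * (norm e)\<^sup>2 \<le> inner G e"
    by linarith
  have "(norm (e - \<alpha> *\<^sub>R G))\<^sup>2 = (norm e)\<^sup>2 - 2 * (\<alpha> * inner G e) + \<alpha> * (\<alpha> * (norm G)\<^sup>2)"
    unfolding power2_norm_eq_inner
    by (simp add: inner_diff_left inner_diff_right inner_commute[of e G] algebra_simps del: dot_square_norm)
  also have "\<dots> \<le> (norm e)\<^sup>2 - 2 * (\<alpha> * inner G e) + \<alpha> * inner G e"
    using G assms(2) by (intro add_left_mono mult_left_mono) auto
  also have "\<dots> \<le> (norm e)\<^sup>2 - \<alpha> * (c2 * (norm e)\<^sup>2)"
    using mult_left_mono[OF c2, of \<alpha>] assms(2) by simp
  finally show ?thesis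
    by (simp add: e_def G_def algebra_simps)
qed

end

section \<open>Perturbed steps and the resulting rate\<close>

context dgd_run
begin

abbreviation "err \<equiv> ebar n p f W \<alpha>"

lemma err_step:
  assumes "coercive \<nu>" "\<alpha> * Lbar n L \<le> 1" "c2 \<le> \<nu> / real n" "0 < \<delta>"
  shows "(norm (err (Suc k)))\<^sup>2 \<le> c3_sq \<alpha> c2 \<delta> * (norm (err k))\<^sup>2 + c4_sq \<alpha> \<delta> (Lh n L) D (beta n W)"
proof -
  define u where "u = err k - (\<alpha> / real n) *\<^sub>R grad p F (avg k)"
  define r where "r = (1 / real n) *\<^sub>R grad p F (avg k) - gavg k"
  define R where "R = \<alpha> * Lh n L * D / (1 - beta n W)"
  have u: "(norm u)\<^sup>2 \<le> (1 - \<alpha> * c2) * (norm (err k))\<^sup>2"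
    unfolding u_def ebar_def
    by (rule gradient_step_contraction[OF assms(1) \<alpha>_pos assms(2,3) avg_in_Rp])
  have r: "(norm r)\<^sup>2 \<le> R\<^sup>2"
    unfolding r_def R_def by (intro power_mono gavg_error) auto
  \<comment> \<open>The old projection is still a minimizer, so measuring from it can only
    overestimate the new error; it leaves the exact step \<open>u\<close> plus
    \<open>\<alpha>\<close> times the gradient error \<open>r\<close>.\<close>
  have "norm (err (Suc k)) \<le> norm (avg (Suc k) - Proj S (avg k))"
    unfolding ebar_def by (intro minimizers_Proj)
  also have "avg (Suc k) - Proj S (avg k) = u + \<alpha> *\<^sub>R r"
    by (simp add: avg_Suc u_def r_def ebar_def algebra_simps)
  finally have "(norm (err (Suc k)))\<^sup>2 \<le> (norm (u + \<alpha> *\<^sub>R r))\<^sup>2"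
    by (intro power_mono) auto
  also have "\<dots> \<le> (1 + \<alpha> * \<delta>) * (norm u)\<^sup>2 + \<alpha> * (\<alpha> + inverse \<delta>) * (norm r)\<^sup>2"
    by (rule norm_sq_perturbed_le[OF assms(4) \<alpha>_pos])
  also have "\<dots> \<le> (1 + \<alpha> * \<delta>) * ((1 - \<alpha> * c2) * (norm (err k))\<^sup>2) + \<alpha> * (\<alpha> + inverse \<delta>) * R\<^sup>2"
    using u r assms(4) \<alpha>_pos by (intro add_mono mult_left_mono) auto
  \<comment> \<open>\<open>c3_sq\<close> factors as
    \<open>(1 + \<alpha> * \<delta>) * (1 - \<alpha> * c2)\<close>.\<close>
  also have "\<dots> = c3_sq \<alpha> c2 \<delta> * (norm (err k))\<^sup>2 + c4_sq \<alpha> \<delta> (Lh n L) D (beta n W)"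
    by (simp add: c3_sq_def c4_sq_def R_def power_divide power_mult_distrib)
      (simp add: power2_eq_square power3_eq_cube algebra_simps)
  finally show ?thesis .
qed

end

text \<open>The additive term is written so that \<open>b\<^sup>2\<close> is a fixed point of the
  recursion for the squares; the root of a sum of two squares is then at most the sum of their
  roots.\<close>

lemma contraction_with_error:
  fixes e :: "nat \<Rightarrow> real"
  assumes step: "\<And>k. (e (Suc k))\<^sup>2 \<le> q * (e k)\<^sup>2 + (1 - q) * b\<^sup>2"
    and q: "0 \<le> q" "q \<le> 1" and "0 \<le> b" "0 \<le> e 0"
  shows "e k \<le> sqrt q ^ k * e 0 + b"
proof -
  have "(e k)\<^sup>2 \<le> q ^ k * (e 0)\<^sup>2 + b\<^sup>2"
  proof (induction k)
    case (Suc k)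
    have "(e (Suc k))\<^sup>2 \<le> q * (q ^ k * (e 0)\<^sup>2 + b\<^sup>2) + (1 - q) * b\<^sup>2"
      using step[of k] mult_left_mono[OF Suc.IH q(1)] by linarith
    then show ?case
      by (simp add: algebra_simps)
  qed simp
  also have "\<dots> \<le> (sqrt q ^ k * e 0 + b)\<^sup>2"
  proof -
    have "(sqrt q ^ k * e 0)\<^sup>2 = q ^ k * (e 0)\<^sup>2"
      using q(1) by (simp add: power_mult_distrib power_even_eq[symmetric] power2_eq_square flip: power_mult_distrib)
    moreover have "0 \<le> sqrt q ^ k * e 0"
      using assms by simp
    ultimately show ?thesis
      using \<open>0 \<le> b\<close> by (simp add: power2_sum)
  qed
  finally show ?thesis
    using assms by (intro power2_le_imp_le[of "e k"]) auto
qed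

text \<open>In \<open>(1 - \<alpha> * c2) * (1 + \<alpha> * \<delta>)\<close> this
  \<open>\<delta>\<close> gives back exactly half of the decrease
  \<open>\<alpha> * c2\<close>.\<close>

lemma c3_sq_optimal:
  assumes "\<alpha> * c2 < 1"
  shows "c3_sq \<alpha> c2 (c2 / (2 * (1 - \<alpha> * c2))) = 1 - \<alpha> * c2 / 2"
proof -
  have "c3_sq \<alpha> c2 \<delta> = (1 - \<alpha> * c2) + \<alpha> * (\<delta> * (1 - \<alpha> * c2))" for \<delta>
    by (simp add: c3_sq_def power2_eq_square algebra_simps)
  moreover have "c2 / (2 * (1 - \<alpha> * c2)) * (1 - \<alpha> * c2) = c2 / 2"
    using assms by (simp add: divide_simps)
  ultimately show ?thesis
    by (simp only:)
qed

text \<open>The factor \<open>\<alpha> * c2 / 2\<close> is one minus the contraction factor, the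
  form that \<open>contraction_with_error\<close> expects; the base of the square is the final
  residual.\<close>

lemma c4_sq_optimal_le:
  assumes "0 < \<alpha>" "0 < c2" "\<alpha> * c2 < 1"
  shows "c4_sq \<alpha> (c2 / (2 * (1 - \<alpha> * c2))) l d b \<le> \<alpha> * c2 / 2 * (2 * \<bar>l\<bar> * \<bar>d\<bar> / \<bar>c2\<bar> * (\<alpha> / (1 - b)))\<^sup>2"
proof -
  have "\<alpha> + inverse (c2 / (2 * (1 - \<alpha> * c2))) = 2 / c2 - \<alpha>"
    using assms by (simp add: field_simps)
  also have "\<dots> \<le> 2 / c2"
    using assms by simp
  finally have "c4_sq \<alpha> (c2 / (2 * (1 - \<alpha> * c2))) l d b \<le> \<alpha>^3 * (2 / c2) * (l\<^sup>2 * d\<^sup>2 / (1 - b)\<^sup>2)"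
    unfolding c4_sq_def using assms by (intro mult_right_mono mult_left_mono) auto
  also have "\<dots> = \<alpha> * c2 / 2 * (2 * \<bar>l\<bar> * \<bar>d\<bar> / \<bar>c2\<bar> * (\<alpha> / (1 - b)))\<^sup>2"
    using assms by (simp add: power_divide power_mult_distrib) (simp add: power2_eq_square power3_eq_cube)
  finally show ?thesis .
qed

theorem theorem3:
  shows "\<exists>C :: real \<Rightarrow> real \<Rightarrow> real \<Rightarrow> real.
    \<forall>(n::nat) (p::nat) (f :: nat \<Rightarrow> fvec \<Rightarrow> real) (L :: nat \<Rightarrow> real) (W :: real mat)
      (\<alpha>::real) (c1::real) (c2::real).
      dgd n p f L W \<longrightarrow>
      strong_constants n p f L c1 c2 \<or> restricted_constants n p f L c1 c2 \<longrightarrow>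
      0 < \<alpha> \<longrightarrow> \<alpha> \<le> min ((1 + eigval W n) / Lh n L) c1 \<longrightarrow>
        (\<forall>\<delta>>0. \<forall>k.
          (norm (ebar n p f W \<alpha> (Suc k)))\<^sup>2
            \<le> c3_sq \<alpha> c2 \<delta> * (norm (ebar n p f W \<alpha> k))\<^sup>2
              + c4_sq \<alpha> \<delta> (Lh n L) (D_const n p f L) (beta n W)) \<and>
        (0 < c2 \<longrightarrow>
          (let \<delta> = c2 / (2 * (1 - \<alpha> * c2)); c3 = sqrt (1 - \<alpha> * c2 / 2) in
            (minimizers p (fsum n f) \<noteq> Rp p \<longrightarrow>
               0 < \<delta> \<and> sqrt (c3_sq \<alpha> c2 \<delta>) = c3 \<and> 0 < c3 \<and> c3 < 1) \<and>
            (\<forall>k. norm (ebar n p f W \<alpha> k)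
               \<le> c3 ^ k * norm (ebar n p f W \<alpha> 0)
                 + C (Lh n L) (D_const n p f L) c2 * (\<alpha> / (1 - beta n W)))))"
\<comment> \<open>The witness is the constant of \<open>c4_sq_optimal_le\<close>; absolute values
  make it nonnegative for all arguments.\<close>
proof (intro exI[of _ "\<lambda>l d c2. 2 * \<bar>l\<bar> * \<bar>d\<bar> / \<bar>c2\<bar>"] allI impI)
  fix n p f L W \<alpha> c1 c2
  assume dgd: "dgd n p f L W"
    and constants: "strong_constants n p f L c1 c2 \<or> restricted_constants n p f L c1 c2"
    and \<alpha>_pos: "0 < \<alpha>" and \<alpha>_le: "\<alpha> \<le> min ((1 + eigval W n) / Lh n L) c1"
  interpret dgd n p f L W
    by (rule dgd)
  interpret dgd_run n p f L W \<alpha>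
    using \<alpha>_pos \<alpha>_le Lh_pos by unfold_locales (simp_all add: pos_le_divide_eq)
  obtain \<nu> where \<nu>: "coercive \<nu>" "\<alpha> * Lbar n L \<le> 1" "c2 \<le> \<nu> / real n"
    and \<alpha>_c2: "S \<noteq> Rp p \<Longrightarrow> \<alpha> * c2 < 1"
    using constants_cases[OF constants \<alpha>_pos] \<alpha>_le by auto
  define \<delta> where "\<delta> = c2 / (2 * (1 - \<alpha> * c2))"
  define c3 where "c3 = sqrt (1 - \<alpha> * c2 / 2)"
  define B where "B = 2 * \<bar>Lh n L\<bar> * \<bar>D\<bar> / \<bar>c2\<bar> * (\<alpha> / (1 - beta n W))"
  have "0 \<le> B"
    using \<alpha>_pos beta_less_1 by (simp add: B_def)
  have optimal: "0 < \<delta>" "c3_sq \<alpha> c2 \<delta> = 1 - \<alpha> * c2 / 2" "0 < c3" "c3 < 1" "0 < 1 - \<alpha> * c2 / 2"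
    if "0 < c2" "S \<noteq> Rp p"
    using \<alpha>_c2[OF that(2)] that(1) \<alpha>_pos c3_sq_optimal[of \<alpha> c2] by (simp_all add: \<delta>_def c3_def)
  have bound: "norm (err k) \<le> c3 ^ k * norm (err 0) + B" if "0 < c2" for k
  proof (cases "S = Rp p")
    case True
    then have "err k = 0" for k
      using avg_in_Rp by (simp add: ebar_def Proj_self)
    then show ?thesis
      using \<open>0 \<le> B\<close> by simp
  next
    case False
    have "(norm (err (Suc k)))\<^sup>2 \<le> (1 - \<alpha> * c2 / 2) * (norm (err k))\<^sup>2 + (1 - (1 - \<alpha> * c2 / 2)) * B\<^sup>2" for k
      using err_step[OF \<nu> optimal(1)[OF that False], of k] optimal(2)[OF that False]
        c4_sq_optimal_le[OF \<alpha>_pos that \<alpha>_c2[OF False], of "Lh n L" D "beta n W"]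
      by (simp add: B_def \<delta>_def)
    then show ?thesis
      unfolding c3_def using optimal(5)[OF that False] that \<alpha>_pos \<open>0 \<le> B\<close>
      by (intro contraction_with_error) auto
  qed
  show "(\<forall>\<delta>>0. \<forall>k. (norm (err (Suc k)))\<^sup>2
        \<le> c3_sq \<alpha> c2 \<delta> * (norm (err k))\<^sup>2 + c4_sq \<alpha> \<delta> (Lh n L) D (beta n W)) \<and>
      (0 < c2 \<longrightarrow>
        (let \<delta> = c2 / (2 * (1 - \<alpha> * c2)); c3 = sqrt (1 - \<alpha> * c2 / 2) in
          (S \<noteq> Rp p \<longrightarrow> 0 < \<delta> \<and> sqrt (c3_sq \<alpha> c2 \<delta>) = c3 \<and> 0 < c3 \<and> c3 < 1) \<and>
          (\<forall>k. norm (err k) \<le> c3 ^ k * norm (err 0)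
            + 2 * \<bar>Lh n L\<bar> * \<bar>D\<bar> / \<bar>c2\<bar> * (\<alpha> / (1 - beta n W)))))"
    unfolding Let_def \<delta>_def[symmetric] c3_def[symmetric] B_def[symmetric]
    using err_step[OF \<nu>] bound optimal by (auto simp: c3_def)
qed

end
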